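(* Let $\mathbb{F}$ be an arbitrary field. (1) For every positive integer $n$, every $M \in \mathrm{GL}_{2n}(\mathbb{F})$ and every diagonal $D \in \mathrm{GL}_{n}(\mathbb{F})$ with $\det(D) = \det(M)$, there exist $A_1,\dots,A_6 \in \mathrm{M}_n(\mathbb{F})$ such that $$ M = \begin{bmatrix} I & 0 \\ A_1 & I \end{bmatrix} \begin{bmatrix} I & A_2 \\ 0 & I \end{bmatrix} \begin{bmatrix} I & 0 \\ A_3 & I \end{bmatrix} \begin{bmatrix} I & A_4 \\ 0 & I \end{bmatrix}\begin{bmatrix} I & 0 \\ A_5 & I \end{bmatrix} \begin{bmatrix} D & A_6 \\ 0 & I \end{bmatrix}.$$ (2) For all positive integers $m,n$ with $m+n>3$, there exists $M \in \mathrm{SL}_{m+n}(\mathbb{F})$ such that $M \notin \big[\mathrm{T}_{m,n}(\mathbb{F})\big]^5$.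
   Context: $\mathrm{M}_{m,n}(\mathbb{F})$ is the set of $m\times n$ matrices over $\mathbb{F}$, and $\mathrm{M}_n(\mathbb{F})=\mathrm{M}_{n,n}(\mathbb{F})$. $\mathrm{GL}_n(\mathbb{F})$ is the group of non-singular $n\times n$ matrices and $\mathrm{SL}_n(\mathbb{F})$ its subgroup of matrices with determinant one. $I$ and $0$ denote the identity and zero matrices of the dimensions dictated by context. For a set $X$ of square matrices of the same size, $X^k$ denotes the set of $k$-fold products $x_1x_2\cdots x_k$ of elements $x_i\in X$. $\mathrm{T}_{m,n}(\mathbb{F})$ denotes the set of $(m+n)\times(m+n)$ matrices of the form $\begin{bmatrix} B & 0 \\ A & C \end{bmatrix}$ with $A\in \mathrm{M}_{n,m}(\mathbb{F})$ or $\begin{bmatrix} B & A \\ 0 & C \end{bmatrix}$ with $A\in \mathrm{M}_{m,n}(\mathbb{F})$, where $B \in \mathrm{GL}_m(\mathbb{F})$ and $C \in \mathrm{GL}_n(\mathbb{F})$ are both diagonal. *)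

theory Defs
  imports "Jordan_Normal_Form.Determinant"
begin

definition GL :: "nat \<Rightarrow> 'a::field mat set" where
  "GL n = {M \<in> carrier_mat n n. invertible_mat M}"

definition SL :: "nat \<Rightarrow> 'a::field mat set" where
  "SL n = {M \<in> GL n. det M = 1}"

text \<open>The set of \<open>k\<close>-fold products of elements of a set \<open>X\<close> of \<open>N \<times> N\<close> matrices. The size \<open>N\<close> is
  a parameter only because the empty product (\<open>k = 0\<close>) needs an identity matrix of known size.\<close>

primrec mat_set_power :: "nat \<Rightarrow> 'a::field mat set \<Rightarrow> nat \<Rightarrow> 'a mat set" where
  "mat_set_power N X 0 = {1\<^sub>m N}"
| "mat_set_power N X (Suc k) = {P * x | P x. P \<in> mat_set_power N X k \<and> x \<in> X}"

definition T_set :: "nat \<Rightarrow> nat \<Rightarrow> 'a::field mat set" where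
  "T_set m n =
     {four_block_mat B (0\<^sub>m m n) A C | A B C.
        A \<in> carrier_mat n m \<and> B \<in> GL m \<and> diagonal_mat B \<and> C \<in> GL n \<and> diagonal_mat C} \<union>
     {four_block_mat B A (0\<^sub>m n m) C | A B C.
        A \<in> carrier_mat m n \<and> B \<in> GL m \<and> diagonal_mat B \<and> C \<in> GL n \<and> diagonal_mat C}"

end

theory Submission
  imports Defs
begin

text \<open>Part 1. Since matrix rings over fields have stable range one, a choice of \<open>A6\<close> makes the upper right
  block of the product of the first five factors invertible, and the problem becomes: for every \<open>h\<close>
  of determinant one find an invertible \<open>X\<close> such that \<open>1 - X = z * Y\<close> and \<open>1 - X * h = Y * z\<close> for some
  \<open>z\<close> and \<open>Y\<close>. For scalar \<open>h\<close> a cyclic permutation matrix \<open>X\<close> is diagonally similar to \<open>X * h\<close>. Otherwise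
  \<open>X\<close> is sought with blocks \<open>1, c, 0, X'\<close>, where \<open>X * h\<close> should be similar to the matrix with blocks
  \<open>1, 0, w, X'\<close>; varying \<open>c\<close> is a state feedback, so by Brunovsky's normal form it suffices that two
  pairs are controllable, and an upper-lower factorisation of a block of \<open>h\<close> produces a suitable
  \<open>X'\<close> over any field.

  Part 2. Five triangular factors collapse to an alternating word, and transposition reduces to words that start
  with a lower factor. If such a word is block diagonal with blocks \<open>a\<close> and \<open>d\<close>, then, up to invertible
  diagonal factors, \<open>a\<close> is \<open>1 - p * w\<^sup>-\<^sup>1 * q\<close> and \<open>d\<close> is \<open>w = \<delta> + q * p\<close> with \<open>\<delta>\<close> diagonal. A trace comparison
  excludes this for suitable \<open>a\<close> and \<open>d\<close> if \<open>m, n \<ge> 2\<close>; if \<open>m = 1\<close> or \<open>n = 1\<close>, a cyclic permutation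
  matrix of size at least three is not a diagonal matrix plus one of rank one.\<close>

section \<open>Block matrices over a field\<close>

text \<open>The origin of \<open>h\<close>: multiplying a matrix with blocks \<open>a\<close>,
  \<open>b\<close>, \<open>c\<close>, \<open>d\<close>, where \<open>b\<close> has inverse
  \<open>b'\<close>, by a unipotent lower factor on either side changes neither \<open>b\<close> nor
  \<open>d * b' * a - c\<close>. The two outer lower factors can therefore be fixed last, and the
  inner upper-lower-upper product only has to realise these two invariants. \<open>h\<close> is the
  second one times \<open>b\<close>, and its determinant is that of the whole block matrix, so the
  condition on \<open>det D\<close> becomes \<open>det h = 1\<close>.

  The obstacle in part 1 is small fields: no scalar in general position is available.
  Controllability takes the place of such choices, because it can be read off from a Hessenberg
  pattern. The relation with \<open>z\<close> and \<open>Y\<close> leaves the borders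
  \<open>c\<close> and \<open>w\<close> independent of each other, so that the two bordered matrices
  need only share the block \<open>X'\<close>.

  In part 2 the test matrices are block diagonal because the vanishing upper right block determines
  the off-diagonal block of the second factor in terms of the third and fourth.\<close>

lemma mat_mult_assoc:
  fixes A :: "'a::semiring_0 mat"
  assumes "dim_col A = dim_row B" "dim_col B = dim_row C"
  shows "A * B * C = A * (B * C)"
  using assms by (intro assoc_mult_mat[of A "dim_row A" "dim_row B" B "dim_row C" C "dim_col C"]) auto

lemma mat_distrib_left:
  fixes A :: "'a::semiring_0 mat"
  assumes "dim_col A = dim_row B" "dim_row B = dim_row C" "dim_col B = dim_col C"
  shows "A * (B + C) = A * B + A * C"
  using assms by (intro mult_add_distrib_mat[of A "dim_row A" "dim_row B" B "dim_col B" C]) auto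

lemma mat_distrib_right:
  fixes A :: "'a::semiring_0 mat"
  assumes "dim_row A = dim_row B" "dim_col A = dim_col B" "dim_col B = dim_row C"
  shows "(A + B) * C = A * C + B * C"
  using assms by (intro add_mult_distrib_mat[of A "dim_row A" "dim_col A" B C "dim_col C"]) auto

lemma mat_minus_distrib_left:
  fixes A :: "'a::ring mat"
  assumes "dim_col A = dim_row B" "dim_row B = dim_row C" "dim_col B = dim_col C"
  shows "A * (B - C) = A * B - A * C"
  using assms by (intro mult_minus_distrib_mat[of A "dim_row A" "dim_row B" B "dim_col B" C]) auto

lemma mat_minus_distrib_right:
  fixes A :: "'a::ring mat"
  assumes "dim_row A = dim_row B" "dim_col A = dim_col B" "dim_col B = dim_row C"
  shows "(A - B) * C = A * C - B * C"
  using assms by (intro minus_mult_distrib_mat[of A "dim_row A" "dim_col A" B C "dim_col C"]) auto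

lemma mat_uminus_left:
  fixes A :: "'a::ring mat"
  assumes "dim_col A = dim_row B"
  shows "(- A) * B = - (A * B)"
  using assms by simp

lemma mat_uminus_right:
  fixes A :: "'a::ring mat"
  assumes "dim_col A = dim_row B"
  shows "A * (- B) = - (A * B)"
  using assms by simp

lemma mat_one_left: "dim_row A = n \<Longrightarrow> 1\<^sub>m n * A = (A :: 'a::semiring_1 mat)"
  by (intro left_mult_one_mat[of A n "dim_col A"]) auto

lemma mat_one_right: "dim_col A = n \<Longrightarrow> A * 1\<^sub>m n = (A :: 'a::semiring_1 mat)"
  by (intro right_mult_one_mat[of A "dim_row A" n]) auto

lemma mat_zero_left: "dim_row A = n \<Longrightarrow> 0\<^sub>m k n * A = 0\<^sub>m k (dim_col (A :: 'a::semiring_0 mat))"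
  by (intro left_mult_zero_mat[of A n "dim_col A"]) auto

lemma mat_zero_right: "dim_col A = n \<Longrightarrow> A * 0\<^sub>m n k = 0\<^sub>m (dim_row (A :: 'a::semiring_0 mat)) k"
  by (intro right_mult_zero_mat[of A "dim_row A" n]) auto

text \<open>Products are normalised with brackets to the right, where \<open>A * B\<close> is not a
  subterm of a longer product; in this form an inverse pair still cancels.\<close>

lemma mat_cancel_left:
  fixes A :: "'a::semiring_1 mat"
  assumes "A * B = 1\<^sub>m n" "dim_col A = dim_row B" "dim_col B = dim_row C" "dim_row C = n"
  shows "A * (B * C) = C"
  using assms mat_mult_assoc[of A B C] by (metis mat_one_left)

text \<open>These versions have equations between dimensions as side conditions. Unlike
  \<open>carrier_mat\<close> premises they leave no dimension undetermined when used as rewrite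
  rules.\<close>

lemmas mat_ring = mat_mult_assoc mat_distrib_left mat_distrib_right mat_minus_distrib_left
  mat_minus_distrib_right mat_uminus_left mat_uminus_right mat_one_left mat_one_right
  mat_zero_left mat_zero_right

lemma mult_four_block:
  fixes A1 :: "'a::semiring_0 mat"
  assumes "dim_row B1 = dim_row A1" "dim_row D1 = dim_row C1" "dim_col C1 = dim_col A1" "dim_col D1 = dim_col B1"
    and "dim_row B2 = dim_row A2" "dim_row D2 = dim_row C2" "dim_col C2 = dim_col A2" "dim_col D2 = dim_col B2"
    and "dim_col A1 = dim_row A2" "dim_col B1 = dim_row C2"
  shows "four_block_mat A1 B1 C1 D1 * four_block_mat A2 B2 C2 D2
    = four_block_mat (A1 * A2 + B1 * C2) (A1 * B2 + B1 * D2) (C1 * A2 + D1 * C2) (C1 * B2 + D1 * D2)"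
  using assms
  by (intro mult_four_block_mat[of _ "dim_row A1" "dim_col A1" _ "dim_col B1" _ "dim_row C1" _ _ "dim_col A2" _ "dim_col B2"]) auto

lemma four_block_eq_iff:
  assumes "A \<in> carrier_mat k l" "B \<in> carrier_mat k l'" "C \<in> carrier_mat k' l" "D \<in> carrier_mat k' l'"
    "A' \<in> carrier_mat k l" "B' \<in> carrier_mat k l'" "C' \<in> carrier_mat k' l" "D' \<in> carrier_mat k' l'"
  shows "four_block_mat A B C D = four_block_mat A' B' C' D' \<longleftrightarrow> A = A' \<and> B = B' \<and> C = C' \<and> D = D'"
    (is "?l = ?r \<longleftrightarrow> _")
proof
  assume eq: "?l = ?r"
  have *: "?l $$ (i,j) = ?r $$ (i,j)" for i j using eq by simp
  have "A = A'"
  proof (rule eq_matI)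
    fix i j assume "i < dim_row A'" "j < dim_col A'"
    then show "A $$ (i,j) = A' $$ (i,j)" using *[of i j] assms by simp
  qed (use assms in auto)
  moreover have "B = B'"
  proof (rule eq_matI)
    fix i j assume "i < dim_row B'" "j < dim_col B'"
    then show "B $$ (i,j) = B' $$ (i,j)" using *[of i "j + l"] assms by simp
  qed (use assms in auto)
  moreover have "C = C'"
  proof (rule eq_matI)
    fix i j assume "i < dim_row C'" "j < dim_col C'"
    then show "C $$ (i,j) = C' $$ (i,j)" using *[of "i + k" j] assms by simp
  qed (use assms in auto)
  moreover have "D = D'"
  proof (rule eq_matI)
    fix i j assume "i < dim_row D'" "j < dim_col D'"
    then show "D $$ (i,j) = D' $$ (i,j)" using *[of "i + k" "j + l"] assms by simp
  qed (use assms in auto)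
  ultimately show "A = A' \<and> B = B' \<and> C = C' \<and> D = D'" by blast
qed auto

lemma four_block_cases:
  assumes "M \<in> carrier_mat (k + k') (l + l')"
  obtains A B C D where "A \<in> carrier_mat k l" "B \<in> carrier_mat k l'" "C \<in> carrier_mat k' l"
    "D \<in> carrier_mat k' l'" "M = four_block_mat A B C D"
proof -
  obtain A B C D where s: "split_block M k l = (A, B, C, D)" by (cases "split_block M k l") auto
  show thesis using that split_block[OF s, of k' l'] assms by auto
qed

lemma one_four_block: "1\<^sub>m (m + n) = four_block_mat (1\<^sub>m m) (0\<^sub>m m n) (0\<^sub>m n m) (1\<^sub>m n)"
  by simp

section \<open>Invertible matrices\<close>

lemma GL_carrier: "A \<in> GL n \<Longrightarrow> A \<in> carrier_mat n n"
  by (simp add: GL_def)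

lemma GL_I:
  fixes A :: "'a::field mat"
  assumes "A \<in> carrier_mat n n" "B \<in> carrier_mat n n" "A * B = 1\<^sub>m n"
  shows "A \<in> GL n"
  using assms mat_mult_left_right_inverse[OF assms]
  unfolding GL_def invertible_mat_def inverts_mat_def by auto

lemma GL_inverse:
  fixes A :: "'a::field mat"
  assumes "A \<in> GL n"
  obtains B where "B \<in> GL n" "A * B = 1\<^sub>m n" "B * A = 1\<^sub>m n"
proof -
  from assms have A: "A \<in> carrier_mat n n" by (rule GL_carrier)
  from assms obtain B where AB: "A * B = 1\<^sub>m n" and BA: "B * A = 1\<^sub>m (dim_row B)"
    unfolding GL_def invertible_mat_def inverts_mat_def by auto
  have "dim_row B = dim_col (B * A)" using BA by (metis index_one_mat(3))
  moreover have "dim_col B = dim_col (A * B)" by simp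
  ultimately have "B \<in> carrier_mat n n" using A AB by auto
  then show thesis using that[of B] AB BA GL_I[of B n A] A by auto
qed

lemma GL_mult:
  fixes A :: "'a::field mat"
  assumes "A \<in> GL n" "B \<in> GL n"
  shows "A * B \<in> GL n"
proof -
  obtain A' where A': "A' \<in> GL n" "A * A' = 1\<^sub>m n" using GL_inverse[OF assms(1)] by auto
  obtain B' where B': "B' \<in> GL n" "B * B' = 1\<^sub>m n" using GL_inverse[OF assms(2)] by auto
  note c = assms[THEN GL_carrier] GL_carrier[OF A'(1)] GL_carrier[OF B'(1)]
  have "A * B * (B' * A') = 1\<^sub>m n"
    using c A' B' by (simp add: mat_mult_assoc mat_cancel_left[OF B'(2)])
  then show ?thesis using c by (intro GL_I[of _ _ "B' * A'"]) auto
qed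

lemma GL_det:
  fixes A :: "'a::field mat"
  shows "A \<in> GL n \<longleftrightarrow> A \<in> carrier_mat n n \<and> det A \<noteq> 0"
proof
  assume "A \<in> GL n"
  then show "A \<in> carrier_mat n n \<and> det A \<noteq> 0"
    by (metis GL_carrier GL_inverse det_mult det_one mult_zero_left zero_neq_one)
next
  assume A: "A \<in> carrier_mat n n \<and> det A \<noteq> 0"
  then have "invertible_mat A" using adj_mat[of A n] 
    unfolding invertible_mat_def inverts_mat_def
    by (auto intro!: exI[of _ "inverse (det A) \<cdot>\<^sub>m adj_mat A"]
        simp: mult_smult_distrib[of _ n n] mult_smult_assoc_mat[of _ n n] intro: eq_matI)
  then show "A \<in> GL n" using A by (simp add: GL_def)
qed

lemma GL_one: "1\<^sub>m n \<in> GL n"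
  by (simp add: GL_det)

text \<open>Keeps the block size \<open>1\<close> from turning into \<open>Suc 0\<close>, so that
  dimensions \<open>1 + m\<close> match syntactically.\<close>

declare One_nat_def [simp del]

text \<open>The counterpart of \<open>append_rows\<close>, encoded as four blocks with an empty
  lower row so that the block product covers it too.\<close>

definition append_columns :: "'a::zero mat \<Rightarrow> 'a mat \<Rightarrow> 'a mat" where
  "append_columns A B = four_block_mat A B (0\<^sub>m 0 (dim_col A)) (0\<^sub>m 0 (dim_col B))"

lemma append_columns_carrier [simp, intro]:
  "A \<in> carrier_mat k l \<Longrightarrow> B \<in> carrier_mat k l' \<Longrightarrow> append_columns A B \<in> carrier_mat k (l + l')"
  unfolding append_columns_def by auto

lemma dim_append_rows [simp]:
  "dim_row (A @\<^sub>r B) = dim_row A + dim_row B" "dim_col (A @\<^sub>r B) = dim_col A"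
  unfolding append_rows_def by auto

lemma dim_append_columns [simp]:
  "dim_row (append_columns A B) = dim_row A" "dim_col (append_columns A B) = dim_col A + dim_col B"
  unfolding append_columns_def by auto

lemma four_block_mult_append_rows:
  fixes A :: "'a::semiring_0 mat"
  assumes "dim_row B = dim_row A" "dim_row D = dim_row C" "dim_col C = dim_col A" "dim_col D = dim_col B"
    and "dim_col A = dim_row x" "dim_col B = dim_row y" "dim_col x = dim_col y"
  shows "four_block_mat A B C D * (x @\<^sub>r y) = (A * x + B * y) @\<^sub>r (C * x + D * y)"
  unfolding append_rows_def using assms
  by (subst mult_four_block) (auto intro!: cong_four_block_mat eq_matI)

lemma append_columns_mult_four_block:
  fixes A :: "'a::semiring_0 mat"
  assumes "dim_row B = dim_row A" "dim_row D = dim_row C" "dim_col C = dim_col A" "dim_col D = dim_col B"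
    and "dim_row A = dim_col x" "dim_row C = dim_col y" "dim_row x = dim_row y"
  shows "append_columns x y * four_block_mat A B C D = append_columns (x * A + y * C) (x * B + y * D)"
  unfolding append_columns_def using assms
  by (subst mult_four_block) (auto intro!: cong_four_block_mat eq_matI)

lemma append_columns_mult_append_rows:
  fixes x :: "'a::semiring_0 mat"
  assumes "dim_row u = dim_col x" "dim_row v = dim_col y" "dim_row x = dim_row y" "dim_col u = dim_col v"
  shows "append_columns x y * (u @\<^sub>r v) = x * u + y * v"
  unfolding append_columns_def append_rows_def using assms
  by (subst mult_four_block) (auto intro!: eq_matI simp del: index_mult_mat(1))

lemma append_rows_mult:
  fixes x :: "'a::semiring_0 mat"
  assumes "dim_col y = dim_col x" "dim_row a = dim_col x"
  shows "(x @\<^sub>r y) * a = (x * a) @\<^sub>r (y * a)"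
  using assms by (intro eq_matI) (auto simp: append_rows_def scalar_prod_def intro!: sum.cong)

lemma append_rows_cases:
  assumes "M \<in> carrier_mat (k + k') l"
  obtains x y where "x \<in> carrier_mat k l" "y \<in> carrier_mat k' l" "M = x @\<^sub>r y"
proof -
  obtain A B C D where *: "A \<in> carrier_mat k l" "B \<in> carrier_mat k 0" "C \<in> carrier_mat k' l"
    "D \<in> carrier_mat k' 0" "M = four_block_mat A B C D"
    by (rule four_block_cases[of M k k' l 0]) (use assms in simp)
  then have "B = 0\<^sub>m k 0" "D = 0\<^sub>m k' 0" by auto
  with * show thesis by (intro that[of A C]) (auto simp: append_rows_def)
qed

lemma append_columns_cases:
  assumes "M \<in> carrier_mat k (l + l')"
  obtains x y where "x \<in> carrier_mat k l" "y \<in> carrier_mat k l'" "M = append_columns x y"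
proof -
  obtain A B C D where *: "A \<in> carrier_mat k l" "B \<in> carrier_mat k l'" "C \<in> carrier_mat 0 l"
    "D \<in> carrier_mat 0 l'" "M = four_block_mat A B C D"
    by (rule four_block_cases[of M k 0 l l']) (use assms in simp)
  then have "C = 0\<^sub>m 0 l" "D = 0\<^sub>m 0 l'" by auto
  with * show thesis by (intro that[of A B]) (auto simp: append_columns_def)
qed

lemma append_rows_eq_iff:
  assumes "x \<in> carrier_mat k l" "y \<in> carrier_mat k' l" "x' \<in> carrier_mat k l" "y' \<in> carrier_mat k' l"
  shows "x @\<^sub>r y = x' @\<^sub>r y' \<longleftrightarrow> x = x' \<and> y = y'"
  unfolding append_rows_def using assms by (subst four_block_eq_iff[of _ k l _ 0 _ k']) auto

lemma zero_append_rows: "0\<^sub>m (k + k') l = 0\<^sub>m k l @\<^sub>r 0\<^sub>m k' l"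
  unfolding append_rows_def by (auto intro!: eq_matI)

lemma zero_append_columns: "0\<^sub>m k (l + l') = append_columns (0\<^sub>m k l) (0\<^sub>m k l')"
  unfolding append_columns_def by (auto intro!: eq_matI)

lemma GL_four_block_lower:
  fixes A :: "'a::field mat"
  assumes "A \<in> GL k" "D \<in> GL l" "C \<in> carrier_mat l k"
  shows "four_block_mat A (0\<^sub>m k l) C D \<in> GL (k + l)"
  using assms by (auto simp: GL_det det_four_block_mat_upper_right_zero[of A k _ l])

lemma GL_four_block_upper:
  fixes A :: "'a::field mat"
  assumes "A \<in> GL k" "D \<in> GL l" "B \<in> carrier_mat k l"
  shows "four_block_mat A B (0\<^sub>m l k) D \<in> GL (k + l)"
  using assms by (auto simp: GL_det det_four_block_mat_lower_left_zero[of A k _ l])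

lemma GL_single:
  fixes x :: "'a::field mat"
  assumes "x \<in> carrier_mat 1 1"
  shows "x \<in> GL 1 \<longleftrightarrow> x \<noteq> 0\<^sub>m 1 1"
proof -
  have "x \<noteq> 0\<^sub>m 1 1 \<longleftrightarrow> x $$ (0,0) \<noteq> 0" using assms by (auto simp: mat_eq_iff)
  then show ?thesis using assms by (auto simp: GL_det det_single)
qed

text \<open>Turns annihilator conditions such as controllability into invertibility.\<close>

lemma GL_left_kernel:
  fixes A :: "'a::field mat"
  assumes A: "A \<in> carrier_mat n n"
    and ker: "\<And>\<xi>. \<xi> \<in> carrier_mat 1 n \<Longrightarrow> \<xi> * A = 0\<^sub>m 1 n \<Longrightarrow> \<xi> = 0\<^sub>m 1 n"
  shows "A \<in> GL n"
proof (rule ccontr)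
  assume "A \<notin> GL n"
  then have "det (transpose_mat A) = 0" using A by (simp add: GL_det det_transpose)
  then obtain v where v: "v \<in> carrier_vec n" "v \<noteq> 0\<^sub>v n" "transpose_mat A *\<^sub>v v = 0\<^sub>v n"
    using det_0_iff_vec_prod_zero[of "transpose_mat A" n] A by auto
  have "mat_of_row v * A = 0\<^sub>m 1 n"
  proof (rule eq_matI)
    fix i j assume ij: "i < dim_row (0\<^sub>m 1 n :: 'a mat)" "j < dim_col (0\<^sub>m 1 n :: 'a mat)"
    have "(transpose_mat A *\<^sub>v v) $ j = 0" using v(3) ij by simp
    then have "col A j \<bullet> v = 0" using ij A by simp
    then show "(mat_of_row v * A) $$ (i,j) = 0\<^sub>m 1 n $$ (i,j)"
      using ij A v(1) comm_scalar_prod[of "col A j" n v] by auto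
  qed (use v A in auto)
  then have "mat_of_row v = 0\<^sub>m 1 n" using ker[of "mat_of_row v"] v(1) by auto
  then have "row (mat_of_row v) 0 = 0\<^sub>v n" by simp
  then show False using v by simp
qed

section \<open>Bases adapted to a vector\<close>

abbreviation e0 :: "nat \<Rightarrow> 'a::field mat" where
  "e0 m \<equiv> 1\<^sub>m 1 @\<^sub>r 0\<^sub>m m 1"

lemma four_block_mult_e0:
  fixes a :: "'a::field mat"
  assumes "a \<in> carrier_mat 1 1" "r \<in> carrier_mat 1 m" "s \<in> carrier_mat m 1" "G \<in> carrier_mat m m"
  shows "four_block_mat a r s G * e0 m = a @\<^sub>r s"
  using assms by (simp add: four_block_mult_append_rows mat_one_right mat_zero_right)

text \<open>The annihilators of \<open>u\<close> and \<open>v\<close> are proper subspaces, and a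
  space is never the union of two of these, even over the field with two elements.\<close>

lemma separating_row:
  fixes u v :: "'a::field mat"
  assumes u: "u \<in> carrier_mat n 1" "u \<noteq> 0\<^sub>m n 1" and v: "v \<in> carrier_mat n 1" "v \<noteq> 0\<^sub>m n 1"
  obtains \<xi> where "\<xi> \<in> carrier_mat 1 n" "\<xi> * v = 1\<^sub>m 1" "\<xi> * u \<noteq> 0\<^sub>m 1 1"
proof -
  obtain i where i: "i < n" "u $$ (i,0) \<noteq> 0" using u by (auto simp: mat_eq_iff)
  obtain j where j: "j < n" "v $$ (j,0) \<noteq> 0" using v by (auto simp: mat_eq_iff)
  define E where "E c k d l = mat 1 n (\<lambda>(_,j). (if j = k then c else 0) + (if j = l then d else (0::'a)))" for c k d l
  have E: "E c k d l \<in> carrier_mat 1 n" for c k d l by (simp add: E_def)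
  have Ex: "E c k d l * x = mat 1 1 (\<lambda>_. c * x $$ (k,0) + d * x $$ (l,0))"
    if "x \<in> carrier_mat n 1" "k < n" "l < n" for x c k d l
    using that by (auto simp: E_def scalar_prod_def distrib_right sum.distrib if_distrib[of "\<lambda>x. x * _"]
        cong: if_cong intro!: eq_matI)
  note witness = that
  have fin: thesis if "k < n" "l < n" "c * v $$ (k,0) + d * v $$ (l,0) = 1"
    "c * u $$ (k,0) + d * u $$ (l,0) \<noteq> 0" for c k d l
    using that E[of c k d l] u v by (intro witness[of "E c k d l"]) (auto simp: Ex mat_eq_iff)
  show thesis
  proof (cases "u $$ (j,0) = 0")
    case False
    then show ?thesis using j by (intro fin[of j j "inverse (v $$ (j,0))" 0]) auto
  next
    case uj: True
    show ?thesis
    proof (cases "v $$ (i,0) = 0")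
      case False
      then show ?thesis using i by (intro fin[of i i "inverse (v $$ (i,0))" 0]) auto
    next
      case True
      \<comment> \<open>Here \<open>u\<close> vanishes at \<open>j\<close> and \<open>v\<close> at
        \<open>i\<close>, so the two coordinates do not interfere.\<close>
      then show ?thesis using i j uj by (intro fin[of j i "inverse (v $$ (j,0))" 1]) auto
    qed
  qed
qed

text \<open>If the first coordinate of \<open>v\<close> is non-zero, a lower triangular matrix sends
  \<open>e0 m\<close> to \<open>v\<close>, and an upper shear then makes the remaining basis vectors
  lie in the kernel of \<open>\<xi>\<close>.\<close>

lemma basis_with_first_covector:
  fixes v :: "'a::field mat"
  assumes v: "v \<in> carrier_mat (1 + m) 1" and \<xi>: "\<xi> \<in> carrier_mat 1 (1 + m)" and \<xi>v: "\<xi> * v = 1\<^sub>m 1"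
  obtains F where "F \<in> GL (1 + m)" "F * e0 m = v" "\<xi> * F = append_columns (1\<^sub>m 1) (0\<^sub>m 1 m)"
proof -
  have main: "\<exists>F \<in> GL (1 + m). F * e0 m = v0 @\<^sub>r v' \<and> append_columns x0 x' * F = append_columns (1\<^sub>m 1) (0\<^sub>m 1 m)"
    if c: "v0 \<in> carrier_mat 1 1" "v' \<in> carrier_mat m 1" "x0 \<in> carrier_mat 1 1" "x' \<in> carrier_mat 1 m"
      and eq: "x0 * v0 + x' * v' = 1\<^sub>m 1" and nz: "v0 \<noteq> 0\<^sub>m 1 1" for v0 v' x0 x' :: "'a mat"
  proof -
    define F where "F = four_block_mat v0 (0\<^sub>m 1 m) v' (1\<^sub>m m) * four_block_mat (1\<^sub>m 1) (- x') (0\<^sub>m m 1) (1\<^sub>m m)"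
    have "F \<in> GL (1 + m)" unfolding F_def using c nz GL_single[of v0] GL_one[of 1, where 'a='a] GL_one[of m, where 'a='a]
      by (intro GL_mult GL_four_block_lower GL_four_block_upper) auto
    moreover have "F = four_block_mat v0 (v0 * (- x')) v' (v' * (- x') + 1\<^sub>m m)"
      unfolding F_def using c by (simp add: mult_four_block mat_ring)
    then have "F * e0 m = v0 @\<^sub>r v'" using c by (simp add: four_block_mult_e0)
    moreover have "append_columns x0 x' * four_block_mat v0 (0\<^sub>m 1 m) v' (1\<^sub>m m) = append_columns (1\<^sub>m 1) x'"
      using c eq by (simp add: append_columns_mult_four_block mat_ring)
    then have "append_columns x0 x' * F = append_columns (1\<^sub>m 1) (0\<^sub>m 1 m)"
      unfolding F_def using c
      by (subst mat_mult_assoc[symmetric])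
         (auto simp: append_columns_mult_four_block mat_ring uminus_l_inv_mat[of x' 1 m])
    ultimately show ?thesis by blast
  qed
  obtain v0 v' where v': "v0 \<in> carrier_mat 1 1" "v' \<in> carrier_mat m 1" "v = v0 @\<^sub>r v'"
    using append_rows_cases[OF v] .
  obtain x0 x' where x': "x0 \<in> carrier_mat 1 1" "x' \<in> carrier_mat 1 m" "\<xi> = append_columns x0 x'"
    using append_columns_cases[OF \<xi>] .
  have eq: "x0 * v0 + x' * v' = 1\<^sub>m 1" using \<xi>v x' v' by (simp add: append_columns_mult_append_rows)
  show thesis
  proof (cases "v0 = 0\<^sub>m 1 1")
    case False
    with main[OF v'(1,2) x'(1,2) eq] show ?thesis using x'(3) v'(3) by (auto intro: that)
  next
    case True
    then have x'v': "x' * v' = 1\<^sub>m 1" using eq x' v' by (simp add: mat_zero_right)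
    \<comment> \<open>As \<open>x' * v' = 1\<close>, this shear sends the vector with parts
      \<open>1\<close> and \<open>v'\<close> to \<open>v\<close>; pulling \<open>\<xi>\<close> back
      along it keeps the pairing equal to one and reduces to the first case.\<close>
    define H where "H = four_block_mat (1\<^sub>m 1) (- x') (0\<^sub>m m 1) (1\<^sub>m m)"
    have "1\<^sub>m 1 \<noteq> (0\<^sub>m 1 1 :: 'a mat)" by (simp add: mat_eq_iff)
    moreover have "x0 * 1\<^sub>m 1 + (- x0 * x' + x') * v' = 1\<^sub>m 1"
      using x' v' x'v' by (auto simp: mat_ring intro!: eq_matI simp del: index_mult_mat(1))
    ultimately obtain F where F: "F \<in> GL (1 + m)" "F * e0 m = 1\<^sub>m 1 @\<^sub>r v'"
      "append_columns x0 (- x0 * x' + x') * F = append_columns (1\<^sub>m 1) (0\<^sub>m 1 m)"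
      using main[of "1\<^sub>m 1" v' x0 "- x0 * x' + x'"] x' v' by auto
    have HG: "H \<in> GL (1 + m)" unfolding H_def using x' by (intro GL_four_block_upper GL_one) auto
    have "H * (1\<^sub>m 1 @\<^sub>r v') = v" unfolding H_def v'(3) True using x' v' x'v'
      by (auto simp: four_block_mult_append_rows mat_ring intro!: arg_cong2[of _ _ _ _ append_rows] eq_matI)
    moreover have "\<xi> * H = append_columns x0 (- x0 * x' + x')" unfolding H_def x'(3) using x'
      by (simp add: append_columns_mult_four_block mat_ring)
    moreover have "H * F * e0 m = H * (F * e0 m)" "\<xi> * (H * F) = \<xi> * H * F"
      using GL_carrier[OF F(1)] GL_carrier[OF HG] \<xi> by (simp_all add: mat_mult_assoc)
    ultimately show ?thesis using F by (intro that[of "H * F"] GL_mult HG) auto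
  qed
qed


text \<open>Complementary blocks of a matrix and its inverse are invertible together: the Schur
  complement of \<open>a'\<close> in the inverse is inverse to \<open>G\<close>.\<close>

lemma schur_complement_GL:
  fixes G :: "'a::field mat"
  assumes c: "a \<in> carrier_mat k k" "r \<in> carrier_mat k m" "s \<in> carrier_mat m k" "G \<in> carrier_mat m m"
    "r' \<in> carrier_mat k m" "s' \<in> carrier_mat m k" "G' \<in> carrier_mat m m"
    and a': "a' \<in> GL k"
    and eq: "four_block_mat a r s G * four_block_mat a' r' s' G' = 1\<^sub>m (k + m)"
  shows "G \<in> GL m"
proof -
  obtain b where b: "b \<in> GL k" "a' * b = 1\<^sub>m k" using GL_inverse[OF a'] by auto
  note c = c GL_carrier[OF a'] GL_carrier[OF b(1)]
  have "four_block_mat (a * a' + r * s') (a * r' + r * G') (s * a' + G * s') (s * r' + G * G')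
      = four_block_mat (1\<^sub>m k) (0\<^sub>m k m) (0\<^sub>m m k) (1\<^sub>m m)"
    using eq c by (simp add: mult_four_block)
  then have 1: "s * a' + G * s' = 0\<^sub>m m k" and 2: "s * r' + G * G' = 1\<^sub>m m"
    using c by (subst (asm) four_block_eq_iff[of _ k k _ m _ m]; simp)+
  have "(s * a' + G * s') * (b * r') = 0\<^sub>m m m" unfolding 1 using c by (simp add: mat_zero_left)
  then have 3: "s * r' + G * (s' * (b * r')) = 0\<^sub>m m m"
    using c by (simp add: mat_ring mat_cancel_left[OF b(2)])
  have "G * (G' - s' * (b * r')) = (s * r' + G * G') - (s * r' + G * (s' * (b * r')))"
    using c by (auto simp: mat_ring intro!: eq_matI simp del: index_mult_mat(1))
  also have "\<dots> = 1\<^sub>m m" unfolding 2 3 by auto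
  finally show ?thesis using c by (intro GL_I[of _ _ "G' - s' * (b * r')"]) auto
qed

text \<open>By the complementary block argument, \<open>G\<close> is invertible once the corner of
  the inverse of \<open>k\<close> is non-zero in the new basis. That corner is
  \<open>\<xi> * (k' * v)\<close>, which is why \<open>\<xi>\<close> has to separate both
  \<open>v\<close> and \<open>k' * v\<close> from zero.\<close>

lemma basis_with_first_vector:
  fixes v :: "'a::field mat"
  assumes k: "k \<in> GL (1 + m)" and v: "v \<in> carrier_mat (1 + m) 1" "v \<noteq> 0\<^sub>m (1 + m) 1"
  obtains F a r s G where "F \<in> GL (1 + m)" "F * e0 m = v" "a \<in> carrier_mat 1 1" "r \<in> carrier_mat 1 m"
    "s \<in> carrier_mat m 1" "G \<in> GL m" "k * F = F * four_block_mat a r s G"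
proof -
  obtain k' where k': "k' \<in> GL (1 + m)" "k * k' = 1\<^sub>m (1 + m)" "k' * k = 1\<^sub>m (1 + m)"
    using GL_inverse[OF k] by auto
  note c = GL_carrier[OF k] GL_carrier[OF k'(1)] v(1)
  have "k * (k' * v) = v" using c by (intro mat_cancel_left[OF k'(2)]) auto
  then have "k' * v \<noteq> 0\<^sub>m (1 + m) 1" using v c mat_zero_right[of k "1 + m" 1] by auto
  then obtain \<xi> where \<xi>: "\<xi> \<in> carrier_mat 1 (1 + m)" "\<xi> * v = 1\<^sub>m 1" "\<xi> * (k' * v) \<noteq> 0\<^sub>m 1 1"
    using separating_row[of "k' * v" "1 + m" v] v c by auto
  obtain F where F: "F \<in> GL (1 + m)" "F * e0 m = v" "\<xi> * F = append_columns (1\<^sub>m 1) (0\<^sub>m 1 m)"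
    using basis_with_first_covector[OF v(1) \<xi>(1,2)] .
  obtain F' where F': "F' \<in> GL (1 + m)" "F * F' = 1\<^sub>m (1 + m)" "F' * F = 1\<^sub>m (1 + m)"
    using GL_inverse[OF F(1)] by auto
  note c = c GL_carrier[OF F(1)] GL_carrier[OF F'(1)]
  have N: "F' * (k * F) \<in> carrier_mat (1 + m) (1 + m)" "F' * (k' * F) \<in> carrier_mat (1 + m) (1 + m)"
    using c by auto
  obtain a r s G where B: "a \<in> carrier_mat 1 1" "r \<in> carrier_mat 1 m" "s \<in> carrier_mat m 1"
    "G \<in> carrier_mat m m" "F' * (k * F) = four_block_mat a r s G"
    using four_block_cases[OF N(1)] .
  obtain a' r' s' G' where B': "a' \<in> carrier_mat 1 1" "r' \<in> carrier_mat 1 m" "s' \<in> carrier_mat m 1"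
    "G' \<in> carrier_mat m m" "F' * (k' * F) = four_block_mat a' r' s' G'"
    using four_block_cases[OF N(2)] .
  have "four_block_mat a r s G * four_block_mat a' r' s' G' = F' * (k * (F * (F' * (k' * F))))"
    unfolding B(5)[symmetric] B'(5)[symmetric] using c by (simp add: mat_mult_assoc)
  also have "\<dots> = 1\<^sub>m (1 + m)"
    using c F'(3) by (simp add: mat_cancel_left[OF F'(2)] mat_cancel_left[OF k'(2)])
  finally have eq: "four_block_mat a r s G * four_block_mat a' r' s' G' = 1\<^sub>m (1 + m)" .
  have "\<xi> * F * (F' * (k' * F) * e0 m) = \<xi> * (k' * v)"
    unfolding F(2)[symmetric] using c \<xi> by (simp add: mat_mult_assoc mat_cancel_left[OF F'(2)])
  moreover have "\<xi> * F * (F' * (k' * F) * e0 m) = a'"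
    unfolding F(3) B'(5) using B'
    by (simp add: four_block_mult_e0 append_columns_mult_append_rows mat_ring)
  ultimately have "a' \<in> GL 1" using \<xi>(3) B'(1) by (simp add: GL_single)
  then have "G \<in> GL m" using schur_complement_GL[OF B(1-4) B'(2-4) _ eq] by blast
  moreover have "k * F = F * four_block_mat a r s G"
    unfolding B(5)[symmetric] using c by (simp add: mat_cancel_left[OF F'(2)])
  ultimately show thesis using that F B by blast
qed

section \<open>Upper-lower factorisation\<close>

text \<open>An upper-lower factorisation \<open>G = U * L\<close> in a suitable basis only needs trailing
  principal blocks to be invertible, which a change of basis achieves over every field.\<close>

definition UL_basis :: "nat \<Rightarrow> 'a::field mat \<Rightarrow> 'a mat \<Rightarrow> 'a mat \<Rightarrow> 'a mat \<Rightarrow> bool" where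
  "UL_basis n G F U L \<longleftrightarrow> F \<in> GL n \<and> U \<in> GL n \<and> L \<in> GL n \<and> upper_triangular U \<and>
    upper_triangular (transpose_mat L) \<and> G * F = F * (U * L)"

text \<open>With a unit corner in \<open>L\<close>, the factorisation of the trailing block
  \<open>G\<close> determines the borders \<open>\<rho>\<close>, \<open>\<mu>\<close> and the corner
  \<open>u\<close>. The change of basis \<open>E\<close> for \<open>G\<close> fixes
  \<open>e0 m\<close>, so the first vector can be prescribed although the induction hypothesis
  prescribes nothing.\<close>

lemma UL_basis_step:
  fixes K :: "'a::field mat"
  assumes K: "K \<in> GL (1 + m)" and v: "v \<in> carrier_mat (1 + m) 1" "v \<noteq> 0\<^sub>m (1 + m) 1"
    and IH: "\<And>G :: 'a mat. G \<in> GL m \<Longrightarrow> \<exists>F U L. UL_basis m G F U L"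
  shows "\<exists>F U L. UL_basis (1 + m) K F U L \<and> F * e0 m = v"
proof -
  obtain F0 a r s G where F0: "F0 \<in> GL (1 + m)" "F0 * e0 m = v" and B: "a \<in> carrier_mat 1 1"
    "r \<in> carrier_mat 1 m" "s \<in> carrier_mat m 1" and G: "G \<in> GL m"
    and KF: "K * F0 = F0 * four_block_mat a r s G"
    using basis_with_first_vector[OF K v] .
  obtain F1 U1 L1 where F1: "F1 \<in> GL m" and U1: "U1 \<in> GL m" "upper_triangular U1"
    and L1: "L1 \<in> GL m" "upper_triangular (transpose_mat L1)" and GF: "G * F1 = F1 * (U1 * L1)"
    using IH[OF G] unfolding UL_basis_def by blast
  obtain F1' where F1': "F1' \<in> GL m" "F1 * F1' = 1\<^sub>m m" using GL_inverse[OF F1] by auto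
  obtain U1' where U1': "U1' \<in> GL m" "U1 * U1' = 1\<^sub>m m" using GL_inverse[OF U1(1)] by auto
  obtain L1' where L1': "L1' \<in> GL m" "L1' * L1 = 1\<^sub>m m" using GL_inverse[OF L1(1)] by auto
  note c = GL_carrier[OF K] GL_carrier[OF F0(1)] B GL_carrier[OF G] GL_carrier[OF F1]
    GL_carrier[OF U1(1)] GL_carrier[OF L1(1)] GL_carrier[OF F1'(1)] GL_carrier[OF U1'(1)] GL_carrier[OF L1'(1)]
  define E where "E = four_block_mat (1\<^sub>m 1) (0\<^sub>m 1 m) (0\<^sub>m m 1) F1"
  define \<rho> where "\<rho> = r * F1 * L1'"
  define \<mu> where "\<mu> = U1' * (F1' * s)"
  define u where "u = a - \<rho> * \<mu>"
  define L where "L = four_block_mat (1\<^sub>m 1) (0\<^sub>m 1 m) \<mu> L1"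
  define U where "U = four_block_mat u \<rho> (0\<^sub>m m 1) U1"
  have d: "\<rho> \<in> carrier_mat 1 m" "\<mu> \<in> carrier_mat m 1" "u \<in> carrier_mat 1 1"
    using c unfolding \<rho>_def \<mu>_def u_def by auto
  have E: "E \<in> GL (1 + m)" unfolding E_def using F1 by (intro GL_four_block_lower GL_one) auto
  have L: "L \<in> GL (1 + m)" unfolding L_def using L1 d by (intro GL_four_block_lower GL_one) auto
  have Uc: "U \<in> carrier_mat (1 + m) (1 + m)" unfolding U_def using c d by auto
  have "u + \<rho> * \<mu> = a" unfolding u_def using c d by (auto intro!: eq_matI simp del: index_mult_mat(1))
  moreover have "\<rho> * L1 = r * F1" unfolding \<rho>_def using c L1' by (simp add: mat_ring)
  moreover have "U1 * \<mu> = F1' * s" unfolding \<mu>_def using c by (simp add: mat_cancel_left[OF U1'(2)])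
  ultimately have UL: "U * L = four_block_mat a (r * F1) (F1' * s) (U1 * L1)"
    unfolding U_def L_def using c d by (simp add: mult_four_block mat_ring)
  have NE: "four_block_mat a r s G * E = E * (U * L)"
    unfolding UL E_def using c by (simp add: mult_four_block mat_ring GF mat_cancel_left[OF F1'(2)])
  have KFE: "K * (F0 * E) = F0 * E * (U * L)"
  proof -
    have "K * (F0 * E) = K * F0 * E" using c GL_carrier[OF E] by (simp add: mat_mult_assoc)
    also have "\<dots> = F0 * (four_block_mat a r s G * E)" unfolding KF using c GL_carrier[OF E] by (simp add: mat_mult_assoc)
    also have "\<dots> = F0 * E * (U * L)" unfolding NE using c GL_carrier[OF E] Uc GL_carrier[OF L] by (simp add: mat_mult_assoc)
    finally show ?thesis .
  qed
  have FE: "F0 * E \<in> GL (1 + m)" using F0 E by (intro GL_mult)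
  \<comment> \<open>That the corner \<open>u\<close> is non-zero is not visible from its definition;
    determinants give it indirectly.\<close>
  have "det K * det (F0 * E) = det (F0 * E) * (det U * det L)"
    using arg_cong[OF KFE, of det] c GL_carrier[OF FE] GL_carrier[OF L] Uc by (simp add: det_mult[of _ "1 + m"])
  then have U: "U \<in> GL (1 + m)" using K FE Uc by (auto simp: GL_det)
  have "upper_triangular U" unfolding U_def using d c U1 
    by (intro upper_triangular_four_block[of _ 1 _ m]) (auto intro!: upper_triangularI)
  moreover have "transpose_mat L = four_block_mat (1\<^sub>m 1) (transpose_mat \<mu>) (0\<^sub>m m 1) (transpose_mat L1)"
    unfolding L_def using d c by (simp add: transpose_four_block_mat[of _ 1 1 _ m _ m])
  then have "upper_triangular (transpose_mat L)" using d c L1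
    by (simp add: upper_triangular_four_block[of _ 1 _ m])
  moreover have "F0 * E * e0 m = v"
  proof -
    have "E * e0 m = e0 m" unfolding E_def using c by (simp add: four_block_mult_e0)
    then show ?thesis using F0(2) c GL_carrier[OF E] by (simp add: mat_mult_assoc)
  qed
  ultimately show ?thesis unfolding UL_basis_def using FE U L KFE by blast
qed

lemma UL_basis_exists:
  fixes K :: "'a::field mat"
  shows "K \<in> GL n \<Longrightarrow> \<exists>F U L. UL_basis n K F U L"
proof (induction n arbitrary: K)
  case 0
  then have "UL_basis 0 K (1\<^sub>m 0) (1\<^sub>m 0) (1\<^sub>m 0)"
    using GL_carrier[OF 0] unfolding UL_basis_def by (auto simp: GL_one)
  then show ?case by blast
next
  case (Suc m)
  have "e0 m \<noteq> (0\<^sub>m (1 + m) 1 :: 'a mat)"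
    unfolding zero_append_rows by (subst append_rows_eq_iff[of _ 1 1 _ m]) (auto simp: mat_eq_iff)
  moreover have "e0 m \<in> carrier_mat (1 + m) 1" by auto
  moreover have "K \<in> GL (1 + m)" using Suc.prems by (simp add: Suc_eq_plus1_left)
  ultimately have "\<exists>F U L. UL_basis (1 + m) K F U L" using UL_basis_step[of K m "e0 m"] Suc.IH by blast
  then show ?case by (simp add: Suc_eq_plus1_left)
qed

lemma UL_basis_first_vector:
  fixes K :: "'a::field mat"
  assumes "K \<in> GL (1 + m)" "v \<in> carrier_mat (1 + m) 1" "v \<noteq> 0\<^sub>m (1 + m) 1"
  obtains F U L where "UL_basis (1 + m) K F U L" "F * e0 m = v"
  using UL_basis_step[OF assms UL_basis_exists] by blast

lemma upper_triangular_GL_diag: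
  fixes U :: "'a::field mat"
  assumes "U \<in> GL n" "upper_triangular U" "i < n"
  shows "U $$ (i,i) \<noteq> 0"
  using assms upper_triangular_imp_det_eq_0_iff[of U n] by (auto simp: GL_det diag_mat_def)

section \<open>Controllable pairs\<close>

lemma GL_pow:
  fixes A :: "'a::field mat"
  shows "A \<in> GL n \<Longrightarrow> A ^\<^sub>m i \<in> GL n"
  by (induction i) (auto simp: GL_mult dest: GL_carrier intro: GL_one)

lemma pow_mat_commute:
  fixes A :: "'a::field mat"
  assumes "A \<in> carrier_mat n n"
  shows "A ^\<^sub>m i * A = A * A ^\<^sub>m i"
proof (induction i)
  case (Suc i)
  have "A ^\<^sub>m Suc i * A = A * A ^\<^sub>m i * A" using Suc by simp
  also have "\<dots> = A * A ^\<^sub>m Suc i" using assms by (simp add: mat_mult_assoc)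
  finally show ?case .
qed (use assms in \<open>simp add: mat_one_left mat_one_right\<close>)

primrec krylov :: "'a::semiring_0 mat \<Rightarrow> 'a mat \<Rightarrow> nat \<Rightarrow> 'a mat" where
  "krylov A v 0 = v"
| "krylov A v (Suc i) = A * krylov A v i"

text \<open>Kalman's rank condition in dual form: that the Krylov vectors span is expressed by the
  absence of a non-zero covector annihilating them.\<close>

definition controllable :: "nat \<Rightarrow> 'a::field mat \<Rightarrow> 'a mat \<Rightarrow> bool" where
  "controllable n A v \<longleftrightarrow> A \<in> carrier_mat n n \<and> v \<in> carrier_mat n 1 \<and>
    (\<forall>\<xi> \<in> carrier_mat 1 n. (\<forall>i<n. \<xi> * krylov A v i = 0\<^sub>m 1 1) \<longrightarrow> \<xi> = 0\<^sub>m 1 n)"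

lemma krylov_carrier [simp]:
  "A \<in> carrier_mat n n \<Longrightarrow> v \<in> carrier_mat n 1 \<Longrightarrow> krylov A v i \<in> carrier_mat n 1"
  by (induction i) auto

lemma dim_krylov [simp]:
  "dim_col (krylov A v i) = dim_col v"
  "dim_row A = dim_row v \<Longrightarrow> dim_row (krylov A v i) = dim_row v"
  by (induction i) auto

lemma controllableD:
  assumes "controllable n A v"
  shows "A \<in> carrier_mat n n" "v \<in> carrier_mat n 1"
  using assms unfolding controllable_def by auto

text \<open>Forward substitution in the coordinate order \<open>\<pi>\<close>.\<close>

lemma triangular_left_kernel:
  fixes \<xi> :: "'a::field mat"
  assumes \<xi>: "\<xi> \<in> carrier_mat 1 n" and u: "\<And>i. i < n \<Longrightarrow> u i \<in> carrier_mat n 1"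
    and \<pi>: "bij_betw \<pi> {..<n} {..<n}"
    and zero: "\<And>i j. i < j \<Longrightarrow> j < n \<Longrightarrow> u i $$ (\<pi> j, 0) = 0"
    and nz: "\<And>i. i < n \<Longrightarrow> u i $$ (\<pi> i, 0) \<noteq> 0"
    and eq: "\<And>i. i < n \<Longrightarrow> \<xi> * u i = 0\<^sub>m 1 1"
  shows "\<xi> = 0\<^sub>m 1 n"
proof -
  have *: "\<xi> $$ (0, \<pi> i) = 0" if "i < n" for i
    using that
  proof (induction i rule: less_induct)
    case (less i)
    have "0 = (\<xi> * u i) $$ (0,0)" using eq[OF less.prems] by simp
    also have "\<dots> = (\<Sum>k\<in>{..<n}. \<xi> $$ (0,k) * u i $$ (k,0))"
      using \<xi> u[OF less.prems] by (simp add: scalar_prod_def atLeast0LessThan)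
    also have "\<dots> = (\<Sum>j\<in>{..<n}. \<xi> $$ (0, \<pi> j) * u i $$ (\<pi> j,0))"
      by (rule sum.reindex_bij_betw[OF \<pi>, symmetric])
    also have "\<dots> = (\<Sum>j\<in>{..<n}. if j = i then \<xi> $$ (0, \<pi> i) * u i $$ (\<pi> i,0) else 0)"
      using less zero by (intro sum.cong) (auto simp: neq_iff)
    also have "\<dots> = \<xi> $$ (0, \<pi> i) * u i $$ (\<pi> i,0)" using less.prems by simp
    finally show ?case using nz[OF less.prems] by simp
  qed
  show ?thesis
  proof (rule eq_matI)
    fix i j assume "i < dim_row (0\<^sub>m 1 n :: 'a mat)" "j < dim_col (0\<^sub>m 1 n :: 'a mat)"
    moreover then obtain k where "k < n" "j = \<pi> k" using \<pi> unfolding bij_betw_def by auto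
    ultimately show "\<xi> $$ (i,j) = 0\<^sub>m 1 n $$ (i,j)" using * by simp
  qed (use \<xi> in auto)
qed

text \<open>The permutation \<open>\<pi>\<close> lets this cover upper Hessenberg matrices and, for the reversal, lower
  Hessenberg ones.\<close>

lemma hessenberg_controllable:
  fixes H :: "'a::field mat"
  assumes H: "H \<in> carrier_mat n n" and v: "v \<in> carrier_mat n 1"
    and \<pi>: "bij_betw \<pi> {..<n} {..<n}"
    and zero: "\<And>i j. Suc j < i \<Longrightarrow> i < n \<Longrightarrow> H $$ (\<pi> i, \<pi> j) = 0"
    and sub: "\<And>j. Suc j < n \<Longrightarrow> H $$ (\<pi> (Suc j), \<pi> j) \<noteq> 0"
    and v0: "\<And>i. 0 < i \<Longrightarrow> i < n \<Longrightarrow> v $$ (\<pi> i, 0) = 0" "0 < n \<Longrightarrow> v $$ (\<pi> 0, 0) \<noteq> 0"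
  shows "controllable n H v"
proof -
  have lt: "\<pi> i < n" if "i < n" for i using \<pi> that unfolding bij_betw_def by auto
  have shape: "(\<forall>j. i < j \<longrightarrow> j < n \<longrightarrow> krylov H v i $$ (\<pi> j, 0) = 0) \<and> krylov H v i $$ (\<pi> i, 0) \<noteq> 0"
    if "i < n" for i
    using that
  proof (induction i)
    case 0
    then show ?case using v0 by simp
  next
    case (Suc i)
    then have IH: "\<And>j. i < j \<Longrightarrow> j < n \<Longrightarrow> krylov H v i $$ (\<pi> j, 0) = 0" "krylov H v i $$ (\<pi> i, 0) \<noteq> 0"
      by auto
    have step: "krylov H v (Suc i) $$ (\<pi> j, 0) = H $$ (\<pi> j, \<pi> i) * krylov H v i $$ (\<pi> i, 0)"
      if "i < j" "j < n" for j
    proof -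
      have "krylov H v (Suc i) $$ (\<pi> j, 0) = (\<Sum>k\<in>{..<n}. H $$ (\<pi> j, k) * krylov H v i $$ (k, 0))"
        using H krylov_carrier[OF H v, of i] lt[OF that(2)] v by (simp add: scalar_prod_def atLeast0LessThan)
      also have "\<dots> = (\<Sum>k\<in>{..<n}. H $$ (\<pi> j, \<pi> k) * krylov H v i $$ (\<pi> k, 0))"
        by (rule sum.reindex_bij_betw[OF \<pi>, symmetric])
      also have "\<dots> = (\<Sum>k\<in>{..<n}. if k = i then H $$ (\<pi> j, \<pi> i) * krylov H v i $$ (\<pi> i, 0) else 0)"
        using IH(1) zero that by (intro sum.cong) (auto simp: neq_iff)
      also have "\<dots> = H $$ (\<pi> j, \<pi> i) * krylov H v i $$ (\<pi> i, 0)" using that by simp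
      finally show ?thesis .
    qed
    show ?case using step zero sub[of i] IH(2) Suc.prems by auto
  qed
  have "\<xi> = 0\<^sub>m 1 n" if "\<xi> \<in> carrier_mat 1 n" "\<forall>i<n. \<xi> * krylov H v i = 0\<^sub>m 1 1" for \<xi>
    using that(1) krylov_carrier[OF H v] \<pi>
  proof (rule triangular_left_kernel)
    show "krylov H v i $$ (\<pi> j, 0) = 0" if "i < j" "j < n" for i j using shape[of i] that by simp
    show "krylov H v i $$ (\<pi> i, 0) \<noteq> 0" if "i < n" for i using shape[of i] that by simp
    show "\<xi> * krylov H v i = 0\<^sub>m 1 1" if "i < n" for i using that \<open>\<forall>i<n. _\<close> by simp
  qed
  then show ?thesis unfolding controllable_def using H v by blast
qed

lemma krylov_similar:
  fixes A :: "'a::field mat"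
  assumes "A \<in> carrier_mat n n" "v \<in> carrier_mat n 1" "T \<in> carrier_mat n n" "T' \<in> carrier_mat n n"
    "T' * T = 1\<^sub>m n"
  shows "krylov (T * A * T') (T * v) i = T * krylov A v i"
proof (induction i)
  case (Suc i)
  then show ?case using assms carrier_matD(1)[OF krylov_carrier[of A n v i]]
    by (simp add: mat_mult_assoc mat_cancel_left[OF assms(5)])
qed simp

lemma controllable_similar:
  fixes A :: "'a::field mat"
  assumes A: "controllable n A v" and T: "T \<in> carrier_mat n n" "T' \<in> carrier_mat n n" "T' * T = 1\<^sub>m n"
  shows "controllable n (T * A * T') (T * v)"
proof -
  note c = controllableD[OF A]
  have TT': "T * T' = 1\<^sub>m n" using T mat_mult_left_right_inverse by blast
  have "\<xi> = 0\<^sub>m 1 n" if \<xi>: "\<xi> \<in> carrier_mat 1 n" and z: "\<And>i. i < n \<Longrightarrow> \<xi> * krylov (T * A * T') (T * v) i = 0\<^sub>m 1 1" for \<xi>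
  proof -
    have "\<xi> * T * krylov A v i = 0\<^sub>m 1 1" if "i < n" for i
      using z[OF that] \<xi> T c unfolding krylov_similar[OF c T] by (simp add: mat_mult_assoc)
    then have "\<xi> * T = 0\<^sub>m 1 n" using A \<xi> T unfolding controllable_def by auto
    then have "\<xi> * T * T' = 0\<^sub>m 1 n" using T by (simp add: mat_zero_left)
    then show ?thesis using \<xi> T TT' by (simp add: mat_mult_assoc mat_one_right)
  qed
  then show ?thesis unfolding controllable_def using c T by auto
qed

lemma pow_krylov_inverse:
  fixes A :: "'a::field mat"
  assumes c: "A \<in> carrier_mat n n" "B \<in> carrier_mat n n" "w \<in> carrier_mat n 1" and AB: "A * B = 1\<^sub>m n"
  shows "j \<le> k \<Longrightarrow> A ^\<^sub>m k * krylov B w j = krylov A w (k - j)"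
proof (induction j arbitrary: k)
  case 0
  show ?case
  proof (induction k)
    case 0
    then show ?case using c by (simp add: mat_one_left)
  next
    case (Suc k)
    have "A ^\<^sub>m i * (A * w) = A * (A ^\<^sub>m i * w)" for i
    proof (induction i)
      case 0
      then show ?case using c by (simp add: mat_one_left)
    next
      case (Suc i)
      have "A ^\<^sub>m Suc i * (A * w) = A ^\<^sub>m i * A * (A * w)" by simp
      also have "\<dots> = A * A ^\<^sub>m i * (A * w)" using pow_mat_commute[OF c(1)] by simp
      also have "\<dots> = A * (A ^\<^sub>m i * A * w)" using c by (simp add: mat_mult_assoc)
      finally show ?case by simp
    qed
    then show ?case using Suc c by (simp add: mat_mult_assoc)
  qed
next
  case (Suc j)
  then obtain k' where k: "k = Suc k'" "j \<le> k'" by (cases k) auto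
  have "A ^\<^sub>m k' \<in> carrier_mat n n" "krylov B w j \<in> carrier_mat n 1" using c by auto
  then show ?case using Suc.IH[OF k(2)] k c by (simp add: mat_mult_assoc mat_cancel_left[OF AB])
qed

text \<open>Multiplication by \<open>A ^\<^sub>m (n - 1)\<close> reverses the list of the first
  \<open>n\<close> Krylov vectors: those of the inverse become those of \<open>A\<close>.\<close>

lemma controllable_inverse:
  fixes A :: "'a::field mat"
  assumes B: "controllable n B w" and A: "A \<in> carrier_mat n n" "A * B = 1\<^sub>m n"
  shows "controllable n A w"
proof -
  note c = controllableD[OF B]
  have "\<xi> = 0\<^sub>m 1 n" if \<xi>: "\<xi> \<in> carrier_mat 1 n" and z: "\<And>i. i < n \<Longrightarrow> \<xi> * krylov A w i = 0\<^sub>m 1 1" for \<xi>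
  proof -
    have P: "A ^\<^sub>m (n - 1) \<in> GL n" using GL_pow[OF GL_I[OF A(1) c(1) A(2)]] .
    then obtain P' where P': "P' \<in> GL n" "A ^\<^sub>m (n - 1) * P' = 1\<^sub>m n" using GL_inverse by blast
    note c' = c GL_carrier[OF P] GL_carrier[OF P'(1)] \<xi>
    have "\<xi> * A ^\<^sub>m (n - 1) * krylov B w j = 0\<^sub>m 1 1" if "j < n" for j
    proof -
      have "\<xi> * A ^\<^sub>m (n - 1) * krylov B w j = \<xi> * (A ^\<^sub>m (n - 1) * krylov B w j)"
        using c' krylov_carrier[OF c, of j] by (intro assoc_mult_mat) auto
      also have "\<dots> = \<xi> * krylov A w (n - 1 - j)"
        using pow_krylov_inverse[OF A(1) c A(2), of j "n - 1"] that by simp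
      also have "\<dots> = 0\<^sub>m 1 1" using z that by simp
      finally show ?thesis .
    qed
    moreover have "\<xi> * A ^\<^sub>m (n - 1) \<in> carrier_mat 1 n" using c' by simp
    ultimately have "\<xi> * A ^\<^sub>m (n - 1) = 0\<^sub>m 1 n" using B unfolding controllable_def by blast
    then have "\<xi> * A ^\<^sub>m (n - 1) * P' = 0\<^sub>m 1 n" using c' by (simp add: mat_zero_left)
    then show ?thesis using c' P'(2) by (simp add: mat_mult_assoc mat_one_right)
  qed
  then show ?thesis unfolding controllable_def using A c by auto
qed

text \<open>The lower parts of the new Krylov vectors start with zero and \<open>s\<close>, and up
  to combinations of earlier ones they run through the Krylov vectors of \<open>B\<close> and
  \<open>s\<close>, whatever \<open>a\<close> and \<open>r\<close> are. The starting vector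
  \<open>e0 m\<close> accounts for the extra coordinate.\<close>

lemma controllable_extend:
  fixes B :: "'a::field mat"
  assumes B: "controllable m B s" and a: "a \<in> carrier_mat 1 1" and r: "r \<in> carrier_mat 1 m"
  shows "controllable (1 + m) (four_block_mat a r s B) (e0 m)"
proof -
  note c = controllableD[OF B] a r
  let ?A = "four_block_mat a r s B"
  define low where "low i = append_columns (0\<^sub>m m 1) (1\<^sub>m m) * krylov ?A (e0 m) i" for i
  define top where "top i = append_columns (1\<^sub>m 1) (0\<^sub>m 1 m) * krylov ?A (e0 m) i" for i
  have A: "?A \<in> carrier_mat (1 + m) (1 + m)" "e0 m \<in> carrier_mat (1 + m) 1" using c by auto
  note k = krylov_carrier[OF A]
  have lc: "low i \<in> carrier_mat m 1" "top i \<in> carrier_mat 1 1" for i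
    using k[of i] unfolding low_def top_def by (auto intro!: carrier_matI)
  have split: "krylov ?A (e0 m) i = top i @\<^sub>r low i" for i
  proof -
    obtain x y where xy: "x \<in> carrier_mat 1 1" "y \<in> carrier_mat m 1" "krylov ?A (e0 m) i = x @\<^sub>r y"
      using append_rows_cases[OF k] .
    then show ?thesis unfolding low_def top_def xy(3)
      by (simp add: append_columns_mult_append_rows mat_ring)
  qed
  have "krylov ?A (e0 m) (Suc i) = (a * top i + r * low i) @\<^sub>r (s * top i + B * low i)" for i
    using c lc[of i] by (simp add: split four_block_mult_append_rows)
  then have low_Suc: "low (Suc i) = s * top i + B * low i" for i
    using split[of "Suc i"] lc[of i] lc[of "Suc i"] c
      append_rows_eq_iff[of "top (Suc i)" 1 1 "low (Suc i)" m "a * top i + r * low i" "s * top i + B * low i"]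
    by auto
  have "1\<^sub>m 1 @\<^sub>r 0\<^sub>m m 1 = top 0 @\<^sub>r low 0" using split[of 0] by simp
  then have 0: "top 0 = 1\<^sub>m 1" "low 0 = 0\<^sub>m m 1"
    using lc[of 0] by (subst (asm) append_rows_eq_iff[of _ 1 1 _ m]; auto)+
  then have low1: "low 1 = s" using low_Suc[of 0] c by (simp add: mat_ring One_nat_def)
  \<comment> \<open>Once \<open>\<xi>'\<close> kills \<open>s\<close>, the row
    \<open>\<xi>' * B\<close> kills a list that is one shorter; hence the induction with
    \<open>\<xi>'\<close> arbitrary.\<close>
  have tri: "\<forall>i<k. \<xi>' * krylov B s i = 0\<^sub>m 1 1"
    if "\<forall>i<k. \<xi>' * low (Suc i) = 0\<^sub>m 1 1" "\<xi>' \<in> carrier_mat 1 m" for \<xi>' k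
    using that
  proof (induction k arbitrary: \<xi>')
    case (Suc k)
    have s0: "\<xi>' * s = 0\<^sub>m 1 1" using Suc.prems(1)[rule_format, of 0] low1 by (simp add: One_nat_def)
    have "\<xi>' * B * low (Suc i) = 0\<^sub>m 1 1" if "i < k" for i
    proof -
      have "0\<^sub>m 1 1 = \<xi>' * low (Suc (Suc i))" using Suc.prems(1) that by simp
      also have "\<dots> = \<xi>' * s * top (Suc i) + \<xi>' * B * low (Suc i)"
        unfolding low_Suc[of "Suc i"] using c lc[of "Suc i"] Suc.prems(2) by (simp add: mat_ring del: krylov.simps)
      also have "\<dots> = \<xi>' * B * low (Suc i)" unfolding s0 using c lc[of "Suc i"] Suc.prems(2)
        by (simp add: mat_zero_left)
      finally show ?thesis by simp
    qed
    then have "\<forall>i<k. \<xi>' * B * krylov B s i = 0\<^sub>m 1 1" using Suc.IH[of "\<xi>' * B"] Suc.prems(2) c by auto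
    then have *: "\<xi>' * krylov B s (Suc i) = 0\<^sub>m 1 1" if "i < k" for i
      using that c Suc.prems(2) carrier_matD(1)[OF krylov_carrier[OF c(1,2), of i]] by (simp add: mat_mult_assoc)
    show ?case
    proof (intro allI impI)
      fix i assume "i < Suc k"
      then show "\<xi>' * krylov B s i = 0\<^sub>m 1 1" using * s0 by (cases i) auto
    qed
  qed simp
  have "\<xi> = 0\<^sub>m 1 (1 + m)" if \<xi>: "\<xi> \<in> carrier_mat 1 (1 + m)"
    and z: "\<And>i. i < 1 + m \<Longrightarrow> \<xi> * krylov ?A (e0 m) i = 0\<^sub>m 1 1" for \<xi>
  proof -
    obtain x y where xy: "x \<in> carrier_mat 1 1" "y \<in> carrier_mat 1 m" "\<xi> = append_columns x y"
      using append_columns_cases[OF \<xi>] .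
    have e: "x * top i + y * low i = 0\<^sub>m 1 1" if "i < 1 + m" for i
      using z[OF that] xy lc[of i] unfolding split by (simp add: append_columns_mult_append_rows)
    have x: "x = 0\<^sub>m 1 1" using e[of 0] 0 xy by (simp add: mat_ring)
    have "y * low (Suc i) = 0\<^sub>m 1 1" if "i < m" for i
      using e[of "Suc i"] that x xy lc[of "Suc i"] by (simp add: mat_ring)
    then have "\<forall>i<m. y * krylov B s i = 0\<^sub>m 1 1" using tri[of m y] xy by auto
    then have "y = 0\<^sub>m 1 m" using B xy unfolding controllable_def by blast
    then show ?thesis using x xy by (simp add: zero_append_columns)
  qed
  then show ?thesis unfolding controllable_def using A by blast
qed

section \<open>Brunovsky's normal form and feedback\<close>

definition shift_mat :: "nat \<Rightarrow> 'a::field mat" where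
  "shift_mat n = mat n n (\<lambda>(i,j). if j = Suc i then 1 else 0)"

text \<open>Together with \<open>shift_mat\<close> this is the normal form of a single-input system:
  a nilpotent chain driven at its last coordinate.\<close>

definition last_col :: "nat \<Rightarrow> 'a::field mat" where
  "last_col n = mat n 1 (\<lambda>(i,_). if Suc i = n then 1 else 0)"

lemma shift_last_carrier [simp]: "shift_mat n \<in> carrier_mat n n" "last_col n \<in> carrier_mat n 1"
  by (simp_all add: shift_mat_def last_col_def)

definition stack_rows :: "nat \<Rightarrow> nat \<Rightarrow> (nat \<Rightarrow> 'a mat) \<Rightarrow> 'a mat" where
  "stack_rows k n \<rho> = mat k n (\<lambda>(i,j). \<rho> i $$ (0,j))"

lemma stack_rows_carrier [simp]: "stack_rows k n \<rho> \<in> carrier_mat k n"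
  by (simp add: stack_rows_def)

lemma stack_rows_mult:
  fixes X :: "'a::field mat"
  assumes "\<And>i. i < k \<Longrightarrow> \<rho> i \<in> carrier_mat 1 n" "X \<in> carrier_mat n l"
  shows "stack_rows k n \<rho> * X = stack_rows k l (\<lambda>i. \<rho> i * X)"
proof (rule eq_matI)
  fix i j assume "i < dim_row (stack_rows k l (\<lambda>i. \<rho> i * X))" "j < dim_col (stack_rows k l (\<lambda>i. \<rho> i * X))"
  then have ij: "i < k" "j < l" by (auto simp: stack_rows_def)
  then show "(stack_rows k n \<rho> * X) $$ (i,j) = stack_rows k l (\<lambda>i. \<rho> i * X) $$ (i,j)"
    using assms(1)[OF ij(1)] assms(2) by (auto simp: stack_rows_def scalar_prod_def intro!: sum.cong)
qed (use assms in \<open>auto simp: stack_rows_def\<close>)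

lemma shift_mat_mult:
  fixes R :: "'a::field mat"
  assumes "R \<in> carrier_mat n l"
  shows "shift_mat n * R = mat n l (\<lambda>(i,j). if Suc i < n then R $$ (Suc i, j) else 0)"
proof (rule eq_matI)
  fix i j assume "i < dim_row (mat n l (\<lambda>(i,j). if Suc i < n then R $$ (Suc i, j) else 0))"
    "j < dim_col (mat n l (\<lambda>(i,j). if Suc i < n then R $$ (Suc i, j) else 0))"
  then have ij: "i < n" "j < l" by auto
  have "(shift_mat n * R) $$ (i,j) = (\<Sum>k = 0..<n. (if k = Suc i then 1 else 0) * R $$ (k,j))"
    using ij assms by (simp add: shift_mat_def scalar_prod_def)
  also have "\<dots> = (\<Sum>k = 0..<n. if k = Suc i then R $$ (k,j) else 0)" by (intro sum.cong) auto
  finally show "(shift_mat n * R) $$ (i,j) = mat n l (\<lambda>(i,j). if Suc i < n then R $$ (Suc i, j) else 0) $$ (i,j)"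
    using ij by simp
qed (use assms in \<open>auto simp: shift_mat_def\<close>)

text \<open>A row \<open>\<xi>\<close> dual to the last Krylov vector turns the rows \<open>\<xi> * A ^ i\<close> into coordinates in which
  \<open>A\<close> is a companion matrix; the feedback \<open>v * \<kappa>\<close> then clears its last row.\<close>

lemma brunovsky_form:
  fixes A :: "'a::field mat"
  assumes "controllable n A v"
  obtains R \<kappa> where "R \<in> GL n" "\<kappa> \<in> carrier_mat 1 n" "R * (A + v * \<kappa>) = shift_mat n * R" "R * v = last_col n"
proof -
  note c = controllableD[OF assms]
  define K where "K = mat n n (\<lambda>(i,j). krylov A v j $$ (i,0))"
  have K: "K \<in> carrier_mat n n" by (simp add: K_def)
  have rowK: "(\<xi> * K) $$ (0,j) = (\<xi> * krylov A v j) $$ (0,0)"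
    if "\<xi> \<in> carrier_mat 1 n" "j < n" for \<xi> j
    using that c krylov_carrier[OF c, of j] by (auto simp: K_def scalar_prod_def intro!: sum.cong)
  have "K \<in> GL n"
  proof (rule GL_left_kernel[OF K])
    fix \<xi> :: "'a mat" assume \<xi>: "\<xi> \<in> carrier_mat 1 n" "\<xi> * K = 0\<^sub>m 1 n"
    have "\<xi> * krylov A v i = 0\<^sub>m 1 1" if "i < n" for i
      using rowK[OF \<xi>(1) that] \<xi> that krylov_carrier[OF c, of i] by (intro eq_matI) (auto simp: One_nat_def)
    then show "\<xi> = 0\<^sub>m 1 n" using assms \<xi>(1) unfolding controllable_def by blast
  qed
  then obtain K' where K': "K' \<in> GL n" "K' * K = 1\<^sub>m n" using GL_inverse by blast
  note c = c K GL_carrier[OF K'(1)]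
  define \<xi> where "\<xi> = mat 1 n (\<lambda>(_,j). if Suc j = n then 1 else (0::'a)) * K'"
  have \<xi>: "\<xi> \<in> carrier_mat 1 n" unfolding \<xi>_def using c by auto
  have "\<xi> * K = mat 1 n (\<lambda>(_,j). if Suc j = n then 1 else 0)"
    unfolding \<xi>_def using c K'(2) by (simp add: mat_mult_assoc mat_one_right)
  then have dual: "\<xi> * krylov A v j = mat 1 1 (\<lambda>_. if Suc j = n then 1 else 0)" if "j < n" for j
    using rowK[OF \<xi> that] \<xi> that krylov_carrier[OF c(1,2), of j] by (intro eq_matI) (auto simp: One_nat_def)
  define \<rho> where "\<rho> i = \<xi> * A ^\<^sub>m i" for i
  have \<rho>: "\<rho> i \<in> carrier_mat 1 n" for i unfolding \<rho>_def using \<xi> c by auto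
  have \<rho>Suc: "\<rho> i * A = \<rho> (Suc i)" for i unfolding \<rho>_def using \<xi> c by (simp add: mat_mult_assoc)
  have \<rho>k: "\<rho> i * krylov A v j = \<xi> * krylov A v (i + j)" for i j
  proof (induction i arbitrary: j)
    case 0
    then show ?case using \<xi> c by (simp add: \<rho>_def mat_one_left)
  next
    case (Suc i)
    have "\<rho> (Suc i) * krylov A v j = \<rho> i * krylov A v (Suc j)"
      unfolding \<rho>Suc[symmetric] using \<rho>[of i] c by (simp add: mat_mult_assoc)
    then show ?case using Suc[of "Suc j"] by simp
  qed
  have \<rho>v: "\<rho> i * v = mat 1 1 (\<lambda>_. if Suc i = n then 1 else 0)" if "i < n" for i
    using \<rho>k[of i 0] dual[OF that] by simp
  define R where "R = stack_rows n n \<rho>"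
  have R: "R \<in> carrier_mat n n" by (simp add: R_def)
  have "R \<in> GL n"
  proof (rule GL_left_kernel[OF R])
    fix \<eta> :: "'a mat" assume \<eta>: "\<eta> \<in> carrier_mat 1 n" "\<eta> * R = 0\<^sub>m 1 n"
    \<comment> \<open>These entries depend only on \<open>j + i\<close>; they vanish below
      \<open>n - 1\<close> and equal one there. The matrix is thus anti-triangular, which explains
      the reversal \<open>bij\<close>.\<close>
    have Rk: "(R * krylov A v i) $$ (j,0) = (\<xi> * krylov A v (j + i)) $$ (0,0)" if "j < n" for i j
      unfolding R_def using that c \<rho> by (subst stack_rows_mult[where l = 1]) (auto simp: stack_rows_def \<rho>k)
    have bij: "bij_betw (\<lambda>i. n - 1 - i) {..<n} {..<n}"
      by (rule bij_betw_byWitness[where f' = "\<lambda>i. n - 1 - i"]) auto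
    have "\<eta> * (R * krylov A v i) = 0\<^sub>m 1 1" for i
    proof -
      have "\<eta> * (R * krylov A v i) = \<eta> * R * krylov A v i"
        using \<eta>(1) R c by (simp add: mat_mult_assoc)
      then show ?thesis unfolding \<eta>(2) using c by (simp add: mat_zero_left)
    qed
    moreover have "R * krylov A v i \<in> carrier_mat n 1" for i
      using R krylov_carrier[OF c(1,2), of i] by simp
    moreover have "(R * krylov A v i) $$ (n - 1 - j, 0) = 0" if "i < j" "j < n" for i j
      using that Rk[of "n - 1 - j" i] dual[of "n - 1 - j + i"] by simp
    moreover have "(R * krylov A v i) $$ (n - 1 - i, 0) \<noteq> 0" if "i < n" for i
      using that Rk[of "n - 1 - i" i] dual[of "n - 1"] by simp
    ultimately show "\<eta> = 0\<^sub>m 1 n"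
      using triangular_left_kernel[OF \<eta>(1), of "\<lambda>i. R * krylov A v i" "\<lambda>i. n - 1 - i"] bij by blast
  qed
  moreover define \<kappa> where "\<kappa> = - \<rho> n"
  have \<kappa>: "\<kappa> \<in> carrier_mat 1 n" unfolding \<kappa>_def using \<rho> by simp
  moreover have "R * (A + v * \<kappa>) = shift_mat n * R"
  proof -
    have "R * (A + v * \<kappa>) = stack_rows n n (\<lambda>i. \<rho> i * (A + v * \<kappa>))"
      unfolding R_def using \<rho> \<kappa> c by (intro stack_rows_mult) auto
    also have "\<dots> = mat n n (\<lambda>(i,j). if Suc i < n then R $$ (Suc i, j) else 0)"
    proof (rule eq_matI)
      fix i j assume "i < dim_row (mat n n (\<lambda>(i,j). if Suc i < n then R $$ (Suc i, j) else 0))"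
        "j < dim_col (mat n n (\<lambda>(i,j). if Suc i < n then R $$ (Suc i, j) else 0))"
      then have ij: "i < n" "j < n" by auto
      have "\<rho> i * (A + v * \<kappa>) = \<rho> (Suc i) + \<rho> i * v * \<kappa>"
        using \<rho>[of i] \<kappa> c by (simp add: mat_ring \<rho>Suc)
      also have "\<dots> $$ (0,j) = (if Suc i < n then R $$ (Suc i, j) else 0)"
      proof (cases "Suc i < n")
        case True
        then have "\<rho> i * v = 0\<^sub>m 1 1" using \<rho>v[OF ij(1)] by auto
        then show ?thesis using True ij \<rho>[of "Suc i"] \<kappa> by (simp add: mat_zero_left R_def stack_rows_def)
      next
        case False
        then have "Suc i = n" "\<rho> i * v = 1\<^sub>m 1" using \<rho>v[OF ij(1)] ij by auto
        then show ?thesis using ij \<rho>[of n] \<kappa> by (simp add: mat_one_left \<kappa>_def)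
      qed
      finally show "stack_rows n n (\<lambda>i. \<rho> i * (A + v * \<kappa>)) $$ (i,j) =
          mat n n (\<lambda>(i,j). if Suc i < n then R $$ (Suc i, j) else 0) $$ (i,j)"
        using ij by (simp add: stack_rows_def)
    qed (simp_all add: stack_rows_def)
    also have "\<dots> = shift_mat n * R" using shift_mat_mult[OF R] by simp
    finally show ?thesis .
  qed
  moreover have "R * v = last_col n"
  proof -
    have "R * v = stack_rows n 1 (\<lambda>i. \<rho> i * v)" unfolding R_def using \<rho> c by (intro stack_rows_mult) auto
    also have "\<dots> = last_col n" by (rule eq_matI) (auto simp: stack_rows_def last_col_def \<rho>v)
    finally show ?thesis .
  qed
  ultimately show thesis by (rule that)
qed

text \<open>Both closed loops are similar to the same shift, and \<open>R' * S\<close> carries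
  \<open>w\<close> to \<open>v\<close>; a feedback along \<open>w\<close> can therefore be moved
  over to \<open>A\<close> as one along \<open>v\<close>.\<close>

lemma feedback_equivalent:
  fixes A B :: "'a::field mat"
  assumes A: "controllable n A v" and B: "controllable n B w"
  obtains Q \<kappa> where "Q \<in> GL n" "\<kappa> \<in> carrier_mat 1 n" "Q * B = (A + v * \<kappa>) * Q"
proof -
  obtain R \<kappa> where R: "R \<in> GL n" "\<kappa> \<in> carrier_mat 1 n" "R * (A + v * \<kappa>) = shift_mat n * R" "R * v = last_col n"
    using brunovsky_form[OF A] .
  obtain S \<mu> where S: "S \<in> GL n" "\<mu> \<in> carrier_mat 1 n" "S * (B + w * \<mu>) = shift_mat n * S" "S * w = last_col n"
    using brunovsky_form[OF B] .
  obtain R' where R': "R' \<in> GL n" "R * R' = 1\<^sub>m n" "R' * R = 1\<^sub>m n" using GL_inverse[OF R(1)] .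
  obtain S' where S': "S' \<in> GL n" "S * S' = 1\<^sub>m n" "S' * S = 1\<^sub>m n" using GL_inverse[OF S(1)] .
  note c = controllableD[OF A] controllableD[OF B] GL_carrier[OF R(1)] GL_carrier[OF S(1)]
    GL_carrier[OF R'(1)] GL_carrier[OF S'(1)] R(2) S(2)
  have v: "v = R' * last_col n" unfolding R(4)[symmetric] using c by (simp add: mat_cancel_left[OF R'(3)])
  have "R' * S * (B + w * \<mu>) = R' * (shift_mat n * S)" using c S(3) by (simp add: mat_mult_assoc)
  also have "\<dots> = R' * (shift_mat n * R) * (R' * S)"
    using c by (simp add: mat_mult_assoc mat_cancel_left[OF R'(2)] shift_mat_def)
  also have "\<dots> = (A + v * \<kappa>) * (R' * S)"
    unfolding R(3)[symmetric] using c by (simp add: mat_cancel_left[OF R'(3)])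
  finally have 1: "R' * S * (B + w * \<mu>) = (A + v * \<kappa>) * (R' * S)" .
  have "R' * S * w = v" unfolding v S(4)[symmetric] using c by (simp add: mat_mult_assoc)
  then have "R' * S * (w * \<mu>) = v * \<mu>" using assoc_mult_mat[of "R' * S" n n w 1 \<mu> n] c by simp
  also have "\<dots> = v * (\<mu> * (S' * R)) * (R' * S)"
    using c by (simp add: mat_mult_assoc mat_cancel_left[OF R'(2)] S'(3) mat_one_right)
  finally have 2: "R' * S * (w * \<mu>) = v * (\<mu> * (S' * R)) * (R' * S)" .
  have "R' * S * B = R' * S * (B + w * \<mu>) - R' * S * (w * \<mu>)"
    using c by (auto simp: mat_distrib_left intro!: eq_matI simp del: index_mult_mat(1))
  also have "\<dots> = (A + v * (\<kappa> - \<mu> * (S' * R))) * (R' * S)"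
    unfolding 1 2 using c by (auto simp: mat_ring intro!: eq_matI simp del: index_mult_mat(1))
  finally have "R' * S * B = (A + v * (\<kappa> - \<mu> * (S' * R))) * (R' * S)" .
  moreover have "R' * S \<in> GL n" using R' S by (intro GL_mult)
  ultimately show thesis using c by (intro that[of "R' * S" "\<kappa> - \<mu> * (S' * R)"]) auto
qed

section \<open>Cyclic permutations and Hessenberg pairs\<close>

definition cycle_mat :: "nat \<Rightarrow> 'a::field mat" where
  "cycle_mat n = mat n n (\<lambda>(i,j). if i = Suc j mod n then 1 else 0)"

lemma cycle_mat_carrier [simp]: "cycle_mat n \<in> carrier_mat n n"
  by (simp add: cycle_mat_def)

lemma Suc_mod_inj: "i < n \<Longrightarrow> j < n \<Longrightarrow> Suc i mod n = Suc j mod n \<longleftrightarrow> i = j"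
  by (auto simp: mod_Suc split: if_splits)

lemma mult_cycle_mat:
  fixes A :: "'a::field mat"
  assumes "A \<in> carrier_mat k n"
  shows "A * cycle_mat n = mat k n (\<lambda>(i,j). A $$ (i, Suc j mod n))"
proof (rule eq_matI)
  fix i j assume "i < dim_row (mat k n (\<lambda>(i,j). A $$ (i, Suc j mod n)))"
    "j < dim_col (mat k n (\<lambda>(i,j). A $$ (i, Suc j mod n)))"
  then have ij: "i < k" "j < n" by auto
  have "(A * cycle_mat n) $$ (i,j) = (\<Sum>l = 0..<n. A $$ (i,l) * (if l = Suc j mod n then 1 else 0))"
    using ij assms by (simp add: cycle_mat_def scalar_prod_def)
  also have "\<dots> = (\<Sum>l = 0..<n. if l = Suc j mod n then A $$ (i,l) else 0)" by (intro sum.cong) auto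
  also have "\<dots> = A $$ (i, Suc j mod n)" using ij by simp
  finally show "(A * cycle_mat n) $$ (i,j) = mat k n (\<lambda>(i,j). A $$ (i, Suc j mod n)) $$ (i,j)"
    using ij by simp
qed (use assms in \<open>auto simp: cycle_mat_def\<close>)

lemma cycle_mat_transpose_mult:
  fixes A :: "'a::field mat"
  assumes "A \<in> carrier_mat n k"
  shows "transpose_mat (cycle_mat n) * A = mat n k (\<lambda>(i,j). A $$ (Suc i mod n, j))"
proof -
  have "transpose_mat (cycle_mat n) * A = transpose_mat (transpose_mat A * cycle_mat n)"
    using assms by (simp add: transpose_mult[of _ k n _ n])
  also have "\<dots> = mat n k (\<lambda>(i,j). A $$ (Suc i mod n, j))"
    using assms by (intro eq_matI) (auto simp: mult_cycle_mat[of _ k])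
  finally show ?thesis .
qed

lemma cycle_mat_inverse: "transpose_mat (cycle_mat n) * cycle_mat n = (1\<^sub>m n :: 'a::field mat)"
proof -
  have "transpose_mat (cycle_mat n) * cycle_mat n = mat n n (\<lambda>(i,j). cycle_mat n $$ (Suc i mod n, j) :: 'a)"
    by (rule cycle_mat_transpose_mult) simp
  also have "\<dots> = 1\<^sub>m n" by (rule eq_matI) (auto simp: cycle_mat_def Suc_mod_inj)
  finally show ?thesis .
qed

lemma cycle_mat_GL: "cycle_mat n \<in> GL n"
  using mat_mult_left_right_inverse[OF _ _ cycle_mat_inverse] by (intro GL_I[where B = "transpose_mat (cycle_mat n)"]) auto

text \<open>Column \<open>j\<close> of the product is column \<open>j + 1\<close> of
  \<open>U\<close>, so the diagonal of \<open>U\<close> becomes the subdiagonal. Only the last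
  column wraps around, and the Hessenberg shape does not restrict it.\<close>

lemma controllable_upper_cycle:
  fixes U :: "'a::field mat"
  assumes U: "U \<in> GL (1 + m)" "upper_triangular U"
  shows "controllable (1 + m) (U * cycle_mat (1 + m)) (e0 m)"
proof (rule hessenberg_controllable[where \<pi> = id])
  note c = GL_carrier[OF U(1)]
  have ent: "(U * cycle_mat (1 + m)) $$ (i,j) = U $$ (i, Suc j)" if "i < 1 + m" "Suc j < 1 + m" for i j
    unfolding mult_cycle_mat[OF c] using that by simp
  show "(U * cycle_mat (1 + m)) $$ (id i, id j) = 0" if "Suc j < i" "i < 1 + m" for i j
    using that ent[of i j] upper_triangularD[OF U(2) that(1)] c by simp
  show "(U * cycle_mat (1 + m)) $$ (id (Suc j), id j) \<noteq> 0" if "Suc j < 1 + m" for j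
    using that ent[of "Suc j" j] upper_triangular_GL_diag[OF U that] by simp
qed (use GL_carrier[OF U(1)] in \<open>auto simp: append_rows_def\<close>)

text \<open>The inverse cycle moves the rows of \<open>L\<close> up by one, so its diagonal becomes
  the superdiagonal. The Krylov vectors grow from the last coordinate upwards, hence the reversed
  order.\<close>

lemma controllable_cycle_lower:
  fixes L :: "'a::field mat"
  assumes L: "L \<in> GL n" "upper_triangular (transpose_mat L)"
  shows "controllable n (transpose_mat (cycle_mat n) * L) (last_col n)"
proof (rule hessenberg_controllable[where \<pi> = "\<lambda>i. n - 1 - i"])
  note c = GL_carrier[OF L(1)]
  have ent: "(transpose_mat (cycle_mat n) * L) $$ (n - 1 - i, n - 1 - j) = L $$ (n - i, n - 1 - j)"
    if "0 < i" "i < n" "j < n" for i j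
  proof -
    have "Suc (n - 1 - i) = n - i" using that by simp
    then show ?thesis unfolding cycle_mat_transpose_mult[OF c] using that by simp
  qed
  have low: "L $$ (i,j) = 0" if "i < j" "j < n" for i j
    using upper_triangularD[OF L(2) that(1)] c that by simp
  have LT: "transpose_mat L \<in> GL n" using L(1) c det_transpose[OF c] by (simp add: GL_det)
  have diag: "L $$ (i,i) \<noteq> 0" if "i < n" for i
    using upper_triangular_GL_diag[OF LT L(2) that] c that by simp
  show "(transpose_mat (cycle_mat n) * L) $$ (n - 1 - i, n - 1 - j) = 0" if "Suc j < i" "i < n" for i j
    using that ent[of i j] low[of "n - i" "n - 1 - j"] by simp
  show "(transpose_mat (cycle_mat n) * L) $$ (n - 1 - Suc j, n - 1 - j) \<noteq> 0" if "Suc j < n" for j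
  proof -
    have "n - 1 - j = n - Suc j" by simp
    then show ?thesis using that diag[of "n - Suc j"] ent[of "Suc j" j] zero_less_Suc diff_less[of "Suc j" n] by (metis Suc_lessD less_trans)
  qed
  show "bij_betw (\<lambda>i. n - 1 - i) {..<n} {..<n}"
    by (rule bij_betw_byWitness[where f' = "\<lambda>i. n - 1 - i"]) auto
  show "transpose_mat (cycle_mat n) * L \<in> carrier_mat n n"
    using c by (auto intro!: carrier_matI simp: cycle_mat_def)
  show "(last_col n :: 'a mat) $$ (n - 1 - i, 0) = 0" if "0 < i" "i < n" for i
    using that by (simp add: last_col_def)
  show "(last_col n :: 'a mat) $$ (n - 1 - 0, 0) \<noteq> 0" if "0 < n"
    using that by (simp add: last_col_def)
qed simp

text \<open>\<open>X = F * L\<^sup>-\<^sup>1 * P * F\<^sup>-\<^sup>1\<close> for the cyclic permutation matrix \<open>P\<close>: then \<open>G * X\<close> and \<open>X\<^sup>-\<^sup>1\<close> are similar to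
  the Hessenberg matrices \<open>U * P\<close> and \<open>P\<^sup>T * L\<close>.\<close>

lemma simultaneously_controllable:
  fixes G :: "'a::field mat"
  assumes G: "G \<in> GL m" and s: "s \<in> carrier_mat m 1" "s \<noteq> 0\<^sub>m m 1"
  obtains X w where "X \<in> GL m" "controllable m X w" "controllable m (X * G) (X * s)"
proof -
  have "m \<noteq> 0" using s by (auto simp: mat_eq_iff)
  then obtain m' where m: "m = 1 + m'" by (cases m) (auto simp: Suc_eq_plus1_left)
  \<comment> \<open>\<open>s\<close> must be the first basis vector because the Hessenberg pair of
    \<open>U * P\<close> is driven by \<open>e0 m'\<close>.\<close>
  obtain F U L where "UL_basis m G F U L" and Fs: "F * e0 m' = s"
    using UL_basis_first_vector[of G m' s] G s unfolding m by auto
  then have F: "F \<in> GL m" and U: "U \<in> GL m" "upper_triangular U"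
    and L: "L \<in> GL m" "upper_triangular (transpose_mat L)" and GF: "G * F = F * (U * L)"
    unfolding UL_basis_def by auto
  obtain F' where F': "F' \<in> GL m" "F * F' = 1\<^sub>m m" "F' * F = 1\<^sub>m m" using GL_inverse[OF F] .
  obtain L' where L': "L' \<in> GL m" "L * L' = 1\<^sub>m m" "L' * L = 1\<^sub>m m" using GL_inverse[OF L(1)] .
  define P where "P = (cycle_mat m :: 'a mat)"
  have P: "P \<in> GL m" "transpose_mat P * P = 1\<^sub>m m" unfolding P_def by (rule cycle_mat_GL cycle_mat_inverse)+
  then have P': "P * transpose_mat P = 1\<^sub>m m"
    using mat_mult_left_right_inverse[of "transpose_mat P" m P] by (simp add: P_def)
  note c = GL_carrier[OF G] s(1) GL_carrier[OF F] GL_carrier[OF U(1)] GL_carrier[OF L(1)]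
    GL_carrier[OF F'(1)] GL_carrier[OF L'(1)] GL_carrier[OF P(1)]
  define X where "X = F * (L' * (P * F'))"
  have X: "X \<in> GL m" unfolding X_def using F L' P F' by (intro GL_mult)
  then obtain Y where Y: "Y \<in> GL m" "X * Y = 1\<^sub>m m" "Y * X = 1\<^sub>m m" by (rule GL_inverse)
  note c = c GL_carrier[OF X] GL_carrier[OF Y(1)]
  have "G * X = G * F * (L' * (P * F'))" unfolding X_def using c by (simp add: mat_mult_assoc)
  also have "\<dots> = F * (U * P) * F'" unfolding GF using c by (simp add: mat_mult_assoc mat_cancel_left[OF L'(2)])
  finally have "controllable m (G * X) s"
    using controllable_similar[of m "U * P" "e0 m'" F F'] controllable_upper_cycle[of U m'] U c F' Fs
    unfolding P_def m by auto
  \<comment> \<open>Conjugation by \<open>X\<close> turns \<open>G * X\<close> and \<open>s\<close>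
    into \<open>X * G\<close> and \<open>X * s\<close>.\<close>
  from controllable_similar[OF this GL_carrier[OF X] GL_carrier[OF Y(1)] Y(3)]
  have "controllable m (X * G) (X * s)" using c Y by (simp add: mat_mult_assoc mat_one_right)
  moreover have "controllable m X (F * last_col m)"
  proof -
    define Z where "Z = F * (transpose_mat P * L) * F'"
    have "X * Z = 1\<^sub>m m" unfolding X_def Z_def using c
      by (simp add: mat_mult_assoc mat_cancel_left[OF F'(3)] mat_cancel_left[OF P'] mat_cancel_left[OF L'(3)] F'(2))
    moreover have "controllable m Z (F * last_col m)" unfolding Z_def
      using controllable_similar[OF controllable_cycle_lower[OF L] GL_carrier[OF F] GL_carrier[OF F'(1)] F'(3)]
      unfolding P_def .
    ultimately show ?thesis using controllable_inverse c by blast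
  qed
  ultimately show thesis using that X by blast
qed

text \<open>Feedback along \<open>e0 m\<close> alters only the first row of \<open>?D * h\<close>.
  As that product is invertible, this is a left multiplication by a matrix \<open>?E\<close> that
  differs from the identity only in its first row, and \<open>?E * ?D\<close> has the required form
  once its corner is one.\<close>

lemma bordered_similarity:
  fixes h :: "'a::field mat"
  assumes c: "a \<in> carrier_mat 1 1" "r \<in> carrier_mat 1 m" "s \<in> carrier_mat m 1" "s \<noteq> 0\<^sub>m m 1"
    and G: "G \<in> GL m" and h: "h = four_block_mat a r s G" and det: "det h = 1"
  obtains X c w T where "X \<in> GL m" "c \<in> carrier_mat 1 m" "w \<in> carrier_mat m 1" "T \<in> GL (1 + m)"
    "four_block_mat (1\<^sub>m 1) c (0\<^sub>m m 1) X * h * T = T * four_block_mat (1\<^sub>m 1) (0\<^sub>m 1 m) w X"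
proof -
  obtain X w where X: "X \<in> GL m" "controllable m X w" "controllable m (X * G) (X * s)"
    using simultaneously_controllable[OF G c(3,4)] .
  note c = c GL_carrier[OF G] GL_carrier[OF X(1)] controllableD[OF X(2)]
  let ?D = "four_block_mat (1\<^sub>m 1) (0\<^sub>m 1 m) (0\<^sub>m m 1) X"
  let ?Y = "four_block_mat (1\<^sub>m 1) (0\<^sub>m 1 m) w X"
  define A where "A = four_block_mat a r (X * s) (X * G)"
  have A: "A = ?D * h" unfolding A_def h using c by (simp add: mult_four_block mat_ring)
  have Ac: "A \<in> carrier_mat (1 + m) (1 + m)" unfolding A_def using c by auto
  have hc: "h \<in> carrier_mat (1 + m) (1 + m)" unfolding h using c by auto
  have detD: "det ?D = det X" using c by (simp add: det_four_block_mat_upper_right_zero[of _ 1 _ m])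
  have detA: "det A = det X" unfolding A using det_mult[of ?D "1 + m" h] hc c det detD by simp
  have "controllable (1 + m) A (e0 m)" unfolding A_def using X c by (intro controllable_extend) auto
  moreover have "controllable (1 + m) ?Y (e0 m)" using X c by (intro controllable_extend) auto
  ultimately obtain Q \<kappa> where Q: "Q \<in> GL (1 + m)" "\<kappa> \<in> carrier_mat 1 (1 + m)" "Q * ?Y = (A + e0 m * \<kappa>) * Q"
    by (rule feedback_equivalent)
  have "A \<in> GL (1 + m)" using Ac detA X by (simp add: GL_det)
  then obtain A' where A': "A' \<in> GL (1 + m)" "A' * A = 1\<^sub>m (1 + m)" using GL_inverse by blast
  have "\<kappa> * A' \<in> carrier_mat 1 (1 + m)" using Q GL_carrier[OF A'(1)] by simp
  then obtain g \<gamma> where g: "g \<in> carrier_mat 1 1" "\<gamma> \<in> carrier_mat 1 m" "\<kappa> * A' = append_columns g \<gamma>"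
    by (rule append_columns_cases)
  have \<kappa>: "\<kappa> = append_columns g \<gamma> * A" unfolding g(3)[symmetric]
    using Q GL_carrier[OF A'(1)] A' Ac by (simp add: mat_mult_assoc mat_one_right)
  let ?E = "four_block_mat (1\<^sub>m 1 + g) \<gamma> (0\<^sub>m m 1) (1\<^sub>m m)"
  have "e0 m * append_columns g \<gamma> = four_block_mat g \<gamma> (0\<^sub>m m 1) (0\<^sub>m m m)"
    unfolding append_columns_def append_rows_def using g by (simp add: mult_four_block mat_ring)
  moreover have "e0 m * \<kappa> = e0 m * append_columns g \<gamma> * A" unfolding \<kappa> using g Ac
    by (simp add: mat_mult_assoc)
  moreover have "1\<^sub>m (1 + m) + four_block_mat g \<gamma> (0\<^sub>m m 1) (0\<^sub>m m m) = ?E"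
    unfolding one_four_block using g by (subst add_four_block_mat[of _ 1 1 _ m _ m]) auto
  ultimately have AE: "A + e0 m * \<kappa> = ?E * A"
    using Ac g mat_distrib_right[of "1\<^sub>m (1 + m)" "four_block_mat g \<gamma> (0\<^sub>m m 1) (0\<^sub>m m m)" A]
    by (simp add: mat_one_left)
  have Ec: "?E \<in> carrier_mat (1 + m) (1 + m)" "?Y \<in> carrier_mat (1 + m) (1 + m)" using g c by auto
  \<comment> \<open>\<open>A\<close> and \<open>?Y\<close> both have determinant
    \<open>det X\<close>, the former because \<open>det h = 1\<close>. Similarity therefore forces
    the corner \<open>1 + g\<close> to be one.\<close>
  have "det Q * det ?Y = det ?E * det A * det Q"
    using arg_cong[OF Q(3), of det] GL_carrier[OF Q(1)] Ec Ac unfolding AE by (simp add: det_mult[of _ "1 + m"])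
  moreover have "det ?Y = det X" using c by (simp add: det_four_block_mat_upper_right_zero[of _ 1 _ m])
  moreover have "det ?E = 1 + g $$ (0,0)"
    using g det_single[of "1\<^sub>m 1 + g"] by (simp add: det_four_block_mat_lower_left_zero[of _ 1 _ m])
  moreover have "det Q \<noteq> 0" "det X \<noteq> 0" using Q(1) X(1) by (auto simp: GL_det)
  ultimately have "g $$ (0,0) = 0" using detA by (simp add: field_simps)
  then have "g = 0\<^sub>m 1 1" using g by (auto simp: mat_eq_iff)
  then have "?E * ?D = four_block_mat (1\<^sub>m 1) (\<gamma> * X) (0\<^sub>m m 1) X"
    using g c by (simp add: mult_four_block mat_ring)
  moreover have "?E * ?D * h = ?E * A" unfolding A using Ec hc c by (intro assoc_mult_mat) auto
  ultimately have "four_block_mat (1\<^sub>m 1) (\<gamma> * X) (0\<^sub>m m 1) X * h * Q = ?E * A * Q" by simp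
  also have "\<dots> = Q * ?Y" using Q(3) unfolding AE by simp
  finally show thesis using that[of X "\<gamma> * X" w Q] X Q g c by auto
qed

section \<open>Six block factors\<close>

text \<open>In bases of source and target in which a non-zero \<open>Q\<close> sends the first
  vector to the first vector, its first column is \<open>e0 m\<close>, and induction applies to the
  trailing block.\<close>

lemma unit_regular:
  fixes Q :: "'a::field mat"
  shows "Q \<in> carrier_mat n n \<Longrightarrow> \<exists>u \<in> GL n. Q * u * Q = Q"
proof (induction n arbitrary: Q)
  case 0
  then show ?case by (intro bexI[of _ "1\<^sub>m 0"] GL_one) auto
next
  case (Suc m)
  then have Q: "Q \<in> carrier_mat (1 + m) (1 + m)" by (simp add: Suc_eq_plus1_left)
  have "\<exists>u \<in> GL (1 + m). Q * u * Q = Q"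
  proof (cases "Q = 0\<^sub>m (1 + m) (1 + m)")
    case True
    then show ?thesis by (intro bexI[of _ "1\<^sub>m (1 + m)"] GL_one) (simp add: mat_zero_left)
  next
    case False
    then obtain i j where ij: "i < 1 + m" "j < 1 + m" "Q $$ (i,j) \<noteq> 0" using Q by (auto simp: mat_eq_iff)
    define x where "x = mat (1 + m) 1 (\<lambda>(k,_). if k = j then 1 else (0::'a))"
    have x: "x \<in> carrier_mat (1 + m) 1" by (simp add: x_def)
    have "(Q * x) $$ (i,0) = (\<Sum>k = 0..<1 + m. Q $$ (i,k) * (if k = j then 1 else 0))"
      using ij Q by (simp add: x_def scalar_prod_def)
    also have "\<dots> = (\<Sum>k = 0..<1 + m. if k = j then Q $$ (i,k) else 0)" by (intro sum.cong) auto
    finally have nz: "(Q * x) $$ (i,0) \<noteq> 0" using ij by simp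
    have "Q * x \<noteq> 0\<^sub>m (1 + m) 1"
    proof
      assume eq: "Q * x = 0\<^sub>m (1 + m) 1"
      show False using nz ij unfolding eq by simp
    qed
    then have y: "Q * x \<in> carrier_mat (1 + m) 1" "Q * x \<noteq> 0\<^sub>m (1 + m) 1" using Q x by auto
    then have x0: "x \<noteq> 0\<^sub>m (1 + m) 1" using Q mat_zero_right[of Q "1 + m" 1] by auto
    \<comment> \<open>Applied to one vector twice, \<open>separating_row\<close> merely supplies a
      dual covector.\<close>
    obtain \<eta> where \<eta>: "\<eta> \<in> carrier_mat 1 (1 + m)" "\<eta> * x = 1\<^sub>m 1" using separating_row[OF x x0 x x0] .
    obtain \<xi> where \<xi>: "\<xi> \<in> carrier_mat 1 (1 + m)" "\<xi> * (Q * x) = 1\<^sub>m 1" using separating_row[OF y y] .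
    obtain F where F: "F \<in> GL (1 + m)" "F * e0 m = x" using basis_with_first_covector[OF x \<eta>] .
    obtain E where E: "E \<in> GL (1 + m)" "E * e0 m = Q * x" using basis_with_first_covector[OF y(1) \<xi>] .
    obtain F' where F': "F' \<in> GL (1 + m)" "F * F' = 1\<^sub>m (1 + m)" "F' * F = 1\<^sub>m (1 + m)" using GL_inverse[OF F(1)] .
    obtain E' where E': "E' \<in> GL (1 + m)" "E * E' = 1\<^sub>m (1 + m)" "E' * E = 1\<^sub>m (1 + m)" using GL_inverse[OF E(1)] .
    note c = Q x GL_carrier[OF F(1)] GL_carrier[OF F'(1)] GL_carrier[OF E(1)] GL_carrier[OF E'(1)]
    have "E' * (Q * F) \<in> carrier_mat (1 + m) (1 + m)" using c by simp
    then obtain a r s G where B: "a \<in> carrier_mat 1 1" "r \<in> carrier_mat 1 m" "s \<in> carrier_mat m 1"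
      "G \<in> carrier_mat m m" "E' * (Q * F) = four_block_mat a r s G" by (rule four_block_cases)
    have "four_block_mat a r s G * e0 m = E' * (Q * (F * e0 m))" unfolding B(5)[symmetric] using c by (simp add: mat_mult_assoc)
    also have "\<dots> = e0 m" unfolding F(2) E(2)[symmetric] using c by (simp add: mat_cancel_left[OF E'(3)])
    finally have "a @\<^sub>r s = e0 m" using four_block_mult_e0[OF B(1-4)] by simp
    then have as: "a = 1\<^sub>m 1" "s = 0\<^sub>m m 1" using append_rows_eq_iff[OF B(1,3), of "1\<^sub>m 1" "0\<^sub>m m 1"] by auto
    obtain u where u: "u \<in> GL m" "G * u * G = G" using Suc.IH[OF B(4)] by blast
    note c' = B(2,4) GL_carrier[OF u(1)]
    \<comment> \<open>The upper right entry is chosen so that \<open>r\<close> cancels in the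
      product of the block matrix with \<open>W\<close>.\<close>
    define W where "W = four_block_mat (1\<^sub>m 1) (- (r * u)) (0\<^sub>m m 1) u"
    have W: "W \<in> GL (1 + m)" unfolding W_def using c' u by (intro GL_four_block_upper GL_one) auto
    note c = c GL_carrier[OF W]
    have "- 0\<^sub>m m m = (0\<^sub>m m m :: 'a mat)" by auto
    then have "four_block_mat a r s G * W * four_block_mat a r s G
      = four_block_mat (1\<^sub>m 1) (r + (- (r * u) + r * u) * G) (0\<^sub>m m 1) (G * u * G)"
      unfolding W_def as using c' by (simp add: mult_four_block mat_mult_assoc mat_one_left mat_one_right mat_zero_left mat_zero_right)
    also have "- (r * u) + r * u = 0\<^sub>m 1 m" using c' by (intro uminus_l_inv_mat) auto
    finally have "four_block_mat a r s G * W * four_block_mat a r s G = four_block_mat a r s G"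
      unfolding as u(2) using c' by (simp add: mat_zero_left)
    then have "E * (E' * (Q * F) * W * (E' * (Q * F))) * F' = E * (E' * (Q * F)) * F'" unfolding B(5) by simp
    then have "Q * (F * W * E') * Q = Q"
      using c by (simp add: mat_mult_assoc mat_cancel_left[OF E'(2)] F'(2) mat_one_right)
    moreover have "F * W * E' \<in> GL (1 + m)" using F W E' by (intro GL_mult)
    ultimately show ?thesis by blast
  qed
  then show ?case by (simp add: Suc_eq_plus1_left)
qed

text \<open>Stable range one: write \<open>Q = E * V\<close> with \<open>E\<close> idempotent and \<open>V\<close> invertible; then
  \<open>P * A * (1 - E) + E\<close> is unipotent.\<close>

lemma stable_range_one:
  fixes P Q :: "'a::field mat"
  assumes c: "P \<in> carrier_mat n n" "Q \<in> carrier_mat n n" "A \<in> carrier_mat n n" "B \<in> carrier_mat n n"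
    and eq: "P * A + Q * B = 1\<^sub>m n"
  obtains X where "X \<in> carrier_mat n n" "P * X + Q \<in> GL n"
proof -
  obtain u where u: "u \<in> GL n" "Q * u * Q = Q" using unit_regular[OF c(2)] by blast
  obtain v where v: "v \<in> GL n" "u * v = 1\<^sub>m n" "v * u = 1\<^sub>m n" using GL_inverse[OF u(1)] .
  note c = c GL_carrier[OF u(1)] GL_carrier[OF v(1)]
  define E where "E = Q * u"
  define C where "C = 1\<^sub>m n - E"
  have E: "E \<in> carrier_mat n n" "C \<in> carrier_mat n n" unfolding E_def C_def using c by auto
  have Q: "Q = E * v" unfolding E_def using c v by (simp add: mat_mult_assoc mat_one_right)
  have EQ: "E * Q = Q" unfolding E_def by (rule u(2))
  have "E * E = E * Q * u" using E c unfolding E_def by (simp add: mat_mult_assoc)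
  then have EE: "E * E = E" unfolding EQ by (simp add: E_def)
  have CC: "C * C = C" and EC: "E * C = 0\<^sub>m n n" and CE: "C * E = 0\<^sub>m n n" and CQ: "C * Q = 0\<^sub>m n n"
    unfolding C_def using E c EE EQ by (auto simp: mat_ring intro!: eq_matI simp del: index_mult_mat(1))
  define S where "S = E * P * A * C"
  have S: "S \<in> carrier_mat n n" unfolding S_def using E c by auto
  \<comment> \<open>\<open>C\<close> annihilates \<open>Q\<close>, so multiplying the relation by
    \<open>C\<close> leaves a statement about \<open>P * A\<close> alone.\<close>
  have "C * (P * A + Q * B) = C * (P * A) + C * Q * B" using c E by (simp add: mat_ring)
  then have CPA: "C * (P * A) = C" unfolding eq CQ using c E by (simp add: mat_zero_left mat_one_right)
  have "P * A * C = (E + C) * (P * A) * C"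
    unfolding C_def using E c by (auto simp: mat_ring intro!: eq_matI simp del: index_mult_mat(1))
  also have "\<dots> = S + C * (P * A) * C" unfolding S_def using E c by (simp add: mat_ring)
  also have "\<dots> = S + C" unfolding CPA CC ..
  finally have PAC: "P * A * C = S + C" .
  have SS: "S * S = 0\<^sub>m n n"
  proof -
    have "S * S = E * P * A * (C * E) * (P * A * C)" unfolding S_def using E c by (simp add: mat_mult_assoc)
    also have "\<dots> = 0\<^sub>m n n" unfolding CE using E c by (simp add: mat_zero_left mat_zero_right)
    finally show ?thesis .
  qed
  have "(1\<^sub>m n + S) * (1\<^sub>m n - S) = 1\<^sub>m n"
    using S SS by (auto simp: mat_ring intro!: eq_matI simp del: index_mult_mat(1))
  then have U: "1\<^sub>m n + S \<in> GL n" using S by (intro GL_I[of _ _ "1\<^sub>m n - S"]) auto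
  have "P * (A * C * v) + Q = (P * A * C + E) * v" unfolding Q using E c by (simp add: mat_ring)
  also have "P * A * C + E = 1\<^sub>m n + S" unfolding PAC unfolding C_def using E S by (auto intro!: eq_matI)
  finally have "P * (A * C * v) + Q \<in> GL n" using U v by (simp add: GL_mult)
  then show thesis using E c by (intro that[of "A * C * v"]) auto
qed

text \<open>If \<open>X\<close> and \<open>X * h\<close> were similar, \<open>h\<close> would be a commutator; the weaker relation below, which
  relates only \<open>1 - X\<close> and \<open>1 - X * h\<close> as products \<open>z * Y\<close> and \<open>Y * z\<close>, also works over the field
  with two elements, where not every \<open>h\<close> of determinant one is a commutator (take \<open>n = 2\<close>).\<close>

definition swap_factors :: "nat \<Rightarrow> 'a::field mat \<Rightarrow> 'a mat \<Rightarrow> 'a mat \<Rightarrow> 'a mat \<Rightarrow> bool" where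
  "swap_factors n h X z Y \<longleftrightarrow> X \<in> GL n \<and> z \<in> carrier_mat n n \<and> Y \<in> carrier_mat n n \<and>
    1\<^sub>m n - X = z * Y \<and> 1\<^sub>m n - X * h = Y * z"

section \<open>Exchanging two factors for a given determinant-one matrix\<close>

lemma swap_factors_scalar:
  fixes \<mu> :: "'a::field"
  assumes \<mu>: "\<mu> ^ n = 1" and n: "n > 0"
  shows "\<exists>X z Y. swap_factors n (\<mu> \<cdot>\<^sub>m 1\<^sub>m n) X z Y"
proof -
  have \<mu>0: "\<mu> \<noteq> 0" using \<mu> n by (auto simp: power_0_left)
  define C where "C = (cycle_mat n :: 'a mat)"
  define T where "T = mat_diag n (\<lambda>i. \<mu> ^ i)"
  define T' where "T' = mat_diag n (\<lambda>i. inverse \<mu> ^ i)"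
  have c: "C \<in> carrier_mat n n" "T \<in> carrier_mat n n" "T' \<in> carrier_mat n n"
    unfolding C_def T_def T'_def by simp_all
  have TT': "T * T' = 1\<^sub>m n" "T' * T = 1\<^sub>m n" unfolding T_def T'_def using \<mu>0
    by (simp_all add: power_mult_distrib[symmetric])
  have TC: "T * C = \<mu> \<cdot>\<^sub>m (C * T)"
  proof (rule eq_matI)
    fix i j assume "i < dim_row (\<mu> \<cdot>\<^sub>m (C * T))" "j < dim_col (\<mu> \<cdot>\<^sub>m (C * T))"
    then have ij: "i < n" "j < n" using c by auto
    \<comment> \<open>The wrap-around entry of the cycle is the only place where
      \<open>\<mu> ^ n = 1\<close> is needed for the similarity.\<close>
    have "\<mu> ^ (Suc j mod n) = \<mu> ^ Suc j" using ij \<mu> by (cases "Suc j = n") auto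
    then show "(T * C) $$ (i,j) = (\<mu> \<cdot>\<^sub>m (C * T)) $$ (i,j)"
      unfolding T_def mat_diag_mult_left[OF c(1)] mat_diag_mult_right[OF c(1)]
      using ij by (auto simp: C_def cycle_mat_def)
  qed (use c in auto)
  have "C * (\<mu> \<cdot>\<^sub>m 1\<^sub>m n) = T * C * T'"
  proof -
    have "T * C * T' = \<mu> \<cdot>\<^sub>m (C * T * T')" unfolding TC using c
      by (intro mult_smult_assoc_mat[of _ n n _ n]) auto
    also have "C * T * T' = C" using c TT' by (simp add: mat_mult_assoc mat_one_right)
    finally show ?thesis using c mult_smult_distrib[of C n n "1\<^sub>m n" n \<mu>] by (simp add: mat_one_right)
  qed
  moreover have "(1\<^sub>m n - C) * T' * T = 1\<^sub>m n - C" using c TT' by (simp add: mat_mult_assoc mat_one_right)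
  moreover have "T * ((1\<^sub>m n - C) * T') = 1\<^sub>m n - T * C * T'" using c TT' by (simp add: mat_ring)
  moreover have "(1\<^sub>m n - C) * T' \<in> carrier_mat n n" using c by (intro mult_carrier_mat[of _ n n]) auto
  \<comment> \<open>Any similarity \<open>X * h = T * X * T'\<close> gives such a pair: one factor
    is \<open>T\<close>, the other is \<open>1 - X\<close> times \<open>T'\<close>.\<close>
  ultimately have "swap_factors n (\<mu> \<cdot>\<^sub>m 1\<^sub>m n) C ((1\<^sub>m n - C) * T') T"
    unfolding swap_factors_def using c cycle_mat_GL[of n, where 'a='a] by (auto simp: C_def)
  then show ?thesis by blast
qed

text \<open>A first basis vector that is not an eigenvector makes the block \<open>s\<close> below
  the corner non-zero, as \<open>bordered_similarity\<close> requires.\<close>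

lemma swap_factors_nonscalar:
  fixes h :: "'a::field mat"
  assumes h: "h \<in> carrier_mat (1 + m) (1 + m)" "det h = 1"
    and v: "v \<in> carrier_mat (1 + m) 1" "v \<noteq> 0\<^sub>m (1 + m) 1" "\<And>a. a \<in> carrier_mat 1 1 \<Longrightarrow> h * v \<noteq> v * a"
  shows "\<exists>X z Y. swap_factors (1 + m) h X z Y"
proof -
  let ?n = "1 + m"
  have hG: "h \<in> GL ?n" using h by (simp add: GL_det)
  obtain F a r s G where F: "F \<in> GL ?n" "F * e0 m = v" and B: "a \<in> carrier_mat 1 1"
    "r \<in> carrier_mat 1 m" "s \<in> carrier_mat m 1" and G: "G \<in> GL m" and hF: "h * F = F * four_block_mat a r s G"
    using basis_with_first_vector[OF hG v(1,2)] .
  obtain F' where F': "F' \<in> GL ?n" "F * F' = 1\<^sub>m ?n" "F' * F = 1\<^sub>m ?n" using GL_inverse[OF F(1)] .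
  define k where "k = four_block_mat a r s G"
  note c = h(1) GL_carrier[OF F(1)] GL_carrier[OF F'(1)]
  have k: "k \<in> carrier_mat ?n ?n" unfolding k_def using B GL_carrier[OF G] by auto
  have "s \<noteq> 0\<^sub>m m 1"
  proof
    assume s: "s = 0\<^sub>m m 1"
    have "h * v = h * F * e0 m" unfolding F(2)[symmetric] using c by (simp add: mat_mult_assoc)
    also have "\<dots> = F * (k * e0 m)" unfolding hF k_def[symmetric] using c k by (simp add: mat_mult_assoc)
    also have "k * e0 m = a @\<^sub>r s" unfolding k_def using B GL_carrier[OF G] by (simp add: four_block_mult_e0)
    also have "\<dots> = e0 m * a" unfolding s using B by (simp add: append_rows_mult mat_one_left mat_zero_left)
    also have "F * (e0 m * a) = v * a" unfolding F(2)[symmetric] using c B by (simp add: mat_mult_assoc)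
    finally show False using v(3)[OF B(1)] by simp
  qed
  moreover have "det k = 1"
    using arg_cong[OF hF, of det] F(1) h k c unfolding k_def[symmetric] by (simp add: det_mult[of _ ?n] GL_det)
  ultimately obtain X0 c0 w T where X0: "X0 \<in> GL m" "c0 \<in> carrier_mat 1 m" "w \<in> carrier_mat m 1" and T: "T \<in> GL ?n"
    and eq: "four_block_mat (1\<^sub>m 1) c0 (0\<^sub>m m 1) X0 * k * T = T * four_block_mat (1\<^sub>m 1) (0\<^sub>m 1 m) w X0"
    using bordered_similarity[OF B _ G k_def] by blast
  obtain T' where T': "T' \<in> GL ?n" "T * T' = 1\<^sub>m ?n" "T' * T = 1\<^sub>m ?n" using GL_inverse[OF T] .
  note b = X0(2,3) GL_carrier[OF X0(1)]
  define X1 where "X1 = four_block_mat (1\<^sub>m 1) c0 (0\<^sub>m m 1) X0"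
  define Y1 where "Y1 = four_block_mat (1\<^sub>m 1) (0\<^sub>m 1 m) w X0"
  \<comment> \<open>\<open>z0\<close> carries both borders. The projection \<open>Y0\<close> erases
    the lower one when multiplied from the right and the upper one from the left, which yields
    \<open>1 - X1\<close> and \<open>1 - Y1\<close> even when \<open>X1\<close> and
    \<open>Y1\<close> are not similar.\<close>
  define z0 where "z0 = four_block_mat (0\<^sub>m 1 1) (- c0) (- w) (1\<^sub>m m - X0)"
  define Y0 where "Y0 = four_block_mat (0\<^sub>m 1 1) (0\<^sub>m 1 m) (0\<^sub>m m 1) (1\<^sub>m m :: 'a mat)"
  have c1: "X1 \<in> carrier_mat ?n ?n" "Y1 \<in> carrier_mat ?n ?n" "z0 \<in> carrier_mat ?n ?n" "Y0 \<in> carrier_mat ?n ?n"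
    unfolding X1_def Y1_def z0_def Y0_def using b by auto
  note c = c k c1 GL_carrier[OF T] GL_carrier[OF T'(1)]
  have X1G: "X1 \<in> GL ?n" unfolding X1_def using X0 by (intro GL_four_block_upper GL_one) auto
  have zY: "z0 * Y0 = 1\<^sub>m ?n - X1"
    unfolding z0_def Y0_def X1_def one_four_block using b
    by (simp add: mult_four_block mat_ring) (auto simp: four_block_mat_def Let_def intro!: eq_matI)
  have Yz: "Y0 * z0 = 1\<^sub>m ?n - Y1"
    unfolding z0_def Y0_def Y1_def one_four_block using b
    by (simp add: mult_four_block mat_ring) (auto simp: four_block_mat_def Let_def intro!: eq_matI)
  have "X1 * k * T * T' = T * Y1 * T'" using eq unfolding X1_def Y1_def by simp
  then have Xk: "X1 * k = T * Y1 * T'" using c by (simp add: mat_mult_assoc T'(2) mat_one_right)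
  have kF: "k * F' = F' * h"
  proof -
    have "k * F' = F' * (F * k) * F'" using c by (simp add: mat_mult_assoc mat_cancel_left[OF F'(3)])
    also have "\<dots> = F' * h" unfolding k_def hF[symmetric] using c by (simp add: mat_mult_assoc F'(2) mat_one_right)
    finally show ?thesis .
  qed
  define X where "X = F * X1 * F'"
  define z where "z = F * z0 * T' * F'"
  define Y where "Y = F * T * Y0 * F'"
  have "z * Y = F * (z0 * Y0) * F'" unfolding z_def Y_def using c
    by (simp add: mat_mult_assoc mat_cancel_left[OF F'(3)] mat_cancel_left[OF T'(3)])
  also have "\<dots> = 1\<^sub>m ?n - X" unfolding zY X_def using c by (simp add: mat_ring F'(2))
  finally have "1\<^sub>m ?n - X = z * Y" by simp
  moreover have "Y * z = F * T * (Y0 * z0) * T' * F'" unfolding z_def Y_def using c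
    by (simp add: mat_mult_assoc mat_cancel_left[OF F'(3)])
  then have "Y * z = 1\<^sub>m ?n - F * (T * Y1 * T') * F'" unfolding Yz
    using c by (simp add: mat_ring mat_cancel_left[OF T'(2)] F'(2))
  moreover have "F * (T * Y1 * T') * F' = X * h" unfolding Xk[symmetric] X_def using c
    by (simp add: mat_mult_assoc kF)
  moreover have "X \<in> GL ?n" unfolding X_def using F X1G F' by (intro GL_mult)
  moreover have "z \<in> carrier_mat ?n ?n" "Y \<in> carrier_mat ?n ?n" unfolding z_def Y_def using c by auto
  ultimately have "swap_factors ?n h X z Y" unfolding swap_factors_def by simp
  then show ?thesis by blast
qed

text \<open>In terms of the factors, \<open>X\<close> is \<open>b' * A2\<close>, \<open>Y\<close> is
  \<open>b' * A4\<close>, and \<open>b * z * b'\<close> is the upper left block of the inner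
  product. The first relation of \<open>swap_factors\<close> makes its upper right block equal to
  \<open>b\<close>, the second gives it the invariant \<open>h * b'\<close>. \<open>A1\<close> and
  \<open>A5\<close> then correct the diagonal blocks, and the lower left block follows from the
  invariant.\<close>

lemma five_block_factors:
  fixes h :: "'a::field mat"
  assumes sw: "swap_factors n h X z Y" and h: "h \<in> carrier_mat n n" 
    and c: "a \<in> carrier_mat n n" "c \<in> carrier_mat n n" "d \<in> carrier_mat n n"
    and b: "b \<in> GL n" "b * b' = 1\<^sub>m n" "b' \<in> carrier_mat n n" and hb: "h * b' = d * (b' * a) - c"
  shows "\<exists>A1 \<in> carrier_mat n n. \<exists>A2 \<in> carrier_mat n n. \<exists>A3 \<in> carrier_mat n n.
    \<exists>A4 \<in> carrier_mat n n. \<exists>A5 \<in> carrier_mat n n. four_block_mat a b c d =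
      four_block_mat (1\<^sub>m n) (0\<^sub>m n n) A1 (1\<^sub>m n) * four_block_mat (1\<^sub>m n) A2 (0\<^sub>m n n) (1\<^sub>m n)
      * four_block_mat (1\<^sub>m n) (0\<^sub>m n n) A3 (1\<^sub>m n) * four_block_mat (1\<^sub>m n) A4 (0\<^sub>m n n) (1\<^sub>m n)
      * four_block_mat (1\<^sub>m n) (0\<^sub>m n n) A5 (1\<^sub>m n)"
proof -
  note cb = c b(3) GL_carrier[OF b(1)] h
  have b'b: "b' * b = 1\<^sub>m n" using mat_mult_left_right_inverse cb b(2) by blast
  from sw have X: "X \<in> GL n" and zY: "z \<in> carrier_mat n n" "Y \<in> carrier_mat n n"
    and e1: "1\<^sub>m n - X = z * Y" and e2: "1\<^sub>m n - X * h = Y * z" unfolding swap_factors_def by auto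
  obtain X' where X': "X' \<in> GL n" "X * X' = 1\<^sub>m n" "X' * X = 1\<^sub>m n" using GL_inverse[OF X] .
  note c = cb zY GL_carrier[OF X] GL_carrier[OF X'(1)]
  \<comment> \<open>\<open>y\<close> and \<open>Z * b'\<close> are to be the lower blocks of the
    inner product. Its invariant demands \<open>h = y * z - Z\<close>, and
    \<open>y = 1 + Z * Y\<close> combined with \<open>X * Z = z - 1\<close> demands
    \<open>X * y = 1 - Y\<close>.\<close>
  define y where "y = X' * (1\<^sub>m n - Y)"
  define Z where "Z = y * z - h"
  have yZ: "y \<in> carrier_mat n n" "Z \<in> carrier_mat n n" unfolding Z_def y_def using c by auto
  note c = c yZ
  have zY': "z * Y = 1\<^sub>m n - X" "Y * z = 1\<^sub>m n - X * h" using e1 e2 by simp_all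
  have Xy: "X * y = 1\<^sub>m n - Y" unfolding y_def using c by (simp add: mat_cancel_left[OF X'(2)])
  have XZ: "X * Z = z - 1\<^sub>m n"
  proof -
    have "X * Z = X * y * z - X * h" unfolding Z_def using c by (simp add: mat_ring)
    also have "\<dots> = z - Y * z - X * h" unfolding Xy using c by (simp add: mat_ring)
    also have "\<dots> = z - 1\<^sub>m n" unfolding zY'(2) using c by (auto intro!: eq_matI simp del: index_mult_mat(1))
    finally show ?thesis .
  qed
  have ZY: "Z * Y = y - 1\<^sub>m n"
  proof -
    have "Z * Y = X' * (X * Z * Y)" using c by (simp add: mat_mult_assoc mat_cancel_left[OF X'(3)])
    also have "X * Z * Y = z * Y - Y" unfolding XZ using c by (simp add: mat_ring)
    also have "X' * (z * Y - Y) = y - X' * X" unfolding zY'(1) y_def using c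
      by (auto simp: mat_ring intro!: eq_matI simp del: index_mult_mat(1))
    finally show ?thesis unfolding X'(3) .
  qed
  define A1 where "A1 = (d - y) * b'"
  define A2 where "A2 = b * X"
  define A3 where "A3 = Z * b'"
  define A4 where "A4 = b * Y"
  define A5 where "A5 = b' * a - z * b'"
  have A: "A1 \<in> carrier_mat n n" "A2 \<in> carrier_mat n n" "A3 \<in> carrier_mat n n" "A4 \<in> carrier_mat n n"
    "A5 \<in> carrier_mat n n" unfolding A1_def A2_def A3_def A4_def A5_def using c by auto
  have A23: "1\<^sub>m n + A2 * A3 = b * z * b'"
  proof -
    have "A2 * A3 = b * (X * Z) * b'" unfolding A2_def A3_def using c by (simp add: mat_mult_assoc)
    also have "\<dots> = b * z * b' - 1\<^sub>m n" unfolding XZ using c by (simp add: mat_ring b(2))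
    finally show ?thesis using c by (auto intro!: eq_matI simp del: index_mult_mat(1))
  qed
  have A34: "A3 * A4 + 1\<^sub>m n = y"
  proof -
    have "A3 * A4 = Z * Y" unfolding A3_def A4_def using c by (simp add: mat_mult_assoc mat_cancel_left[OF b'b])
    then show ?thesis unfolding ZY using c by (auto intro!: eq_matI simp del: index_mult_mat(1))
  qed
  have A234: "b * z * b' * A4 + A2 = b"
  proof -
    have "b * z * b' * A4 = b * (z * Y)" unfolding A4_def using c by (simp add: mat_mult_assoc mat_cancel_left[OF b'b])
    also have "\<dots> + A2 = b" unfolding zY'(1) A2_def using c
      by (auto simp: mat_ring intro!: eq_matI simp del: index_mult_mat(1))
    finally show ?thesis .
  qed
  have A1b: "A1 * b = d - y" unfolding A1_def using c by (simp add: mat_mult_assoc b'b mat_one_right)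
  let ?L = "\<lambda>A. four_block_mat (1\<^sub>m n) (0\<^sub>m n n) A (1\<^sub>m n)" and ?U = "\<lambda>A. four_block_mat (1\<^sub>m n) A (0\<^sub>m n n) (1\<^sub>m n)"
  have "?U A2 * ?L A3 * ?U A4 = four_block_mat (b * z * b') b A3 y"
  proof -
    have "?U A2 * ?L A3 = four_block_mat (b * z * b') A2 A3 (1\<^sub>m n)"
      unfolding A23[symmetric] using A by (simp add: mult_four_block mat_one_left mat_one_right mat_zero_left)
    then have "?U A2 * ?L A3 * ?U A4 = four_block_mat (b * z * b') (b * z * b' * A4 + A2) A3 (A3 * A4 + 1\<^sub>m n)"
      using A c by (simp add: mult_four_block mat_one_left mat_one_right mat_zero_right)
    then show ?thesis unfolding A34 A234 .
  qed
  moreover have "?L A1 * four_block_mat (b * z * b') b A3 y = four_block_mat (b * z * b') b (A1 * b * z * b' + A3) (A1 * b + y)"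
    using A c by (simp add: mult_four_block mat_one_left mat_zero_left mat_mult_assoc)
  moreover have "A1 * b + y = d" unfolding A1b using c by auto
  moreover have "A1 * b * z * b' + A3 = (d * z - h) * b'" unfolding A1b A3_def Z_def using c
    by (auto simp: mat_ring intro!: eq_matI simp del: index_mult_mat(1))
  ultimately have "?L A1 * (?U A2 * ?L A3 * ?U A4) = four_block_mat (b * z * b') b ((d * z - h) * b') d" by simp
  moreover have "four_block_mat (b * z * b') b ((d * z - h) * b') d * ?L A5
    = four_block_mat (b * z * b' + b * A5) b ((d * z - h) * b' + d * A5) d"
    using A c by (simp add: mult_four_block mat_one_right mat_zero_right)
  moreover have "b * z * b' + b * A5 = a" unfolding A5_def using c
    by (simp add: mat_ring mat_cancel_left[OF b(2)]) (auto intro!: eq_matI simp del: index_mult_mat(1))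
  moreover have "(d * z - h) * b' + d * A5 = c" unfolding A5_def using c
    by (simp add: mat_ring hb) (auto intro!: eq_matI simp del: index_mult_mat(1))
  ultimately have "?L A1 * (?U A2 * ?L A3 * ?U A4) * ?L A5 = four_block_mat a b c d" by simp
  moreover have "?L A1 * (?U A2 * ?L A3 * ?U A4) = ?L A1 * ?U A2 * ?L A3 * ?U A4"
    using A by (simp add: mat_mult_assoc)
  ultimately show ?thesis using A by metis
qed

text \<open>If every non-zero vector is an eigenvector, then \<open>h\<close> is scalar; basis
  vectors and sums of two of them suffice to see this.\<close>

lemma swap_factors_exists:
  fixes h :: "'a::field mat"
  assumes h: "h \<in> carrier_mat n n" "det h = 1" and n: "n > 0"
  shows "\<exists>X z Y. swap_factors n h X z Y"
proof (cases "\<exists>v \<in> carrier_mat n 1. v \<noteq> 0\<^sub>m n 1 \<and> (\<forall>a \<in> carrier_mat 1 1. h * v \<noteq> v * a)")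
  case True
  moreover obtain m where "n = 1 + m" using n by (cases n) (auto simp: Suc_eq_plus1_left)
  ultimately show ?thesis using swap_factors_nonscalar[of h m] h by blast
next
  case False
  \<comment> \<open>For \<open>i = j\<close> this is a basis vector; the sums over the set of
    \<open>i\<close> and \<open>j\<close> below collapse accordingly, so one computation serves both
    kinds of vectors.\<close>
  define v where "v i j = mat n 1 (\<lambda>(k,_). if k = i \<or> k = j then 1 else (0::'a))" for i j
  have eig: "\<exists>a. \<forall>k<n. (\<Sum>l\<in>{i,j}. h $$ (k,l)) = (if k = i \<or> k = j then a else 0)" if "i < n" "j < n" for i j
  proof -
    have v: "v i j \<in> carrier_mat n 1" by (simp add: v_def)
    have "v i j $$ (i,0) = 1" using that by (simp add: v_def)
    then have "v i j \<noteq> 0\<^sub>m n 1" using that by auto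
    then obtain a where a: "a \<in> carrier_mat 1 1" "h * v i j = v i j * a" using False v by blast
    have "(\<Sum>l\<in>{i,j}. h $$ (k,l)) = (if k = i \<or> k = j then a $$ (0,0) else 0)" if k: "k < n" for k
    proof -
      have "(\<Sum>l\<in>{i,j}. h $$ (k,l)) = (\<Sum>l = 0..<n. if l \<in> {i,j} then h $$ (k,l) else 0)"
        by (subst sum.inter_restrict[symmetric], simp, rule sum.cong) (use \<open>i < n\<close> \<open>j < n\<close> in auto)
      also have "\<dots> = (h * v i j) $$ (k,0)"
        using k h(1) by (auto simp: v_def scalar_prod_def intro!: sum.cong)
      also have "\<dots> = (if k = i \<or> k = j then a $$ (0,0) else 0)"
        unfolding a(2) using k a(1) by (simp add: v_def scalar_prod_def One_nat_def)
      finally show ?thesis .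
    qed
    then show ?thesis by blast
  qed
  have off: "h $$ (k,i) = 0" if "k < n" "i < n" "k \<noteq> i" for k i
    using eig[of i i] that by auto
  have diag: "h $$ (i,i) = h $$ (0,0)" if "i < n" for i
  proof (cases "i = 0")
    case False
    obtain a where a: "\<forall>k<n. (\<Sum>l\<in>{i,0}. h $$ (k,l)) = (if k = i \<or> k = 0 then a else 0)"
      using eig[OF \<open>i < n\<close> n] by blast
    have "h $$ (i,i) + h $$ (i,0) = a" using a[rule_format, OF \<open>i < n\<close>] False by simp
    moreover have "h $$ (0,i) + h $$ (0,0) = a" using a[rule_format, OF n] False by simp
    ultimately show ?thesis using off[OF \<open>i < n\<close> n False] off[OF n \<open>i < n\<close>] False by simp
  qed simp
  define \<mu> where "\<mu> = h $$ (0,0)"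
  have hs: "h = \<mu> \<cdot>\<^sub>m 1\<^sub>m n"
  proof (rule eq_matI)
    fix i j assume "i < dim_row (\<mu> \<cdot>\<^sub>m 1\<^sub>m n)" "j < dim_col (\<mu> \<cdot>\<^sub>m 1\<^sub>m n)"
    then show "h $$ (i,j) = (\<mu> \<cdot>\<^sub>m 1\<^sub>m n) $$ (i,j)"
      unfolding \<mu>_def using off[of i j] diag[of i] by (cases "i = j") simp_all
  qed (use h(1) in auto)
  then have "\<mu> ^ n = 1" using h(2) det_smult[of \<mu> "1\<^sub>m n"] by simp
  from swap_factors_scalar[OF this n] show ?thesis using hs by simp
qed

text \<open>The last factor absorbs the determinant through \<open>D\<close>, while its free block
  \<open>A6\<close> is spent on making \<open>b\<close> invertible.\<close>

lemma six_block_factors: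
  fixes M :: "'a::field mat"
  assumes n: "n > 0" and M: "M \<in> GL (2 * n)" and D: "D \<in> GL n" and det: "det D = det M"
  shows "\<exists>A1 \<in> carrier_mat n n. \<exists>A2 \<in> carrier_mat n n. \<exists>A3 \<in> carrier_mat n n.
    \<exists>A4 \<in> carrier_mat n n. \<exists>A5 \<in> carrier_mat n n. \<exists>A6 \<in> carrier_mat n n. M =
      four_block_mat (1\<^sub>m n) (0\<^sub>m n n) A1 (1\<^sub>m n) * four_block_mat (1\<^sub>m n) A2 (0\<^sub>m n n) (1\<^sub>m n)
      * four_block_mat (1\<^sub>m n) (0\<^sub>m n n) A3 (1\<^sub>m n) * four_block_mat (1\<^sub>m n) A4 (0\<^sub>m n n) (1\<^sub>m n)
      * four_block_mat (1\<^sub>m n) (0\<^sub>m n n) A5 (1\<^sub>m n) * four_block_mat D A6 (0\<^sub>m n n) (1\<^sub>m n)"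
proof -
  have M: "M \<in> GL (n + n)" using M by (simp add: mult_2)
  obtain M' where M': "M' \<in> GL (n + n)" "M * M' = 1\<^sub>m (n + n)" using GL_inverse[OF M] by auto
  obtain P Q R S where B: "P \<in> carrier_mat n n" "Q \<in> carrier_mat n n" "R \<in> carrier_mat n n" "S \<in> carrier_mat n n"
    "M = four_block_mat P Q R S" using four_block_cases[OF GL_carrier[OF M]] .
  obtain P' Q' R' S' where B': "P' \<in> carrier_mat n n" "Q' \<in> carrier_mat n n" "R' \<in> carrier_mat n n" "S' \<in> carrier_mat n n"
    "M' = four_block_mat P' Q' R' S'" using four_block_cases[OF GL_carrier[OF M'(1)]] .
  have "four_block_mat (P * P' + Q * R') (P * Q' + Q * S') (R * P' + S * R') (R * Q' + S * S')
      = four_block_mat (1\<^sub>m n) (0\<^sub>m n n) (0\<^sub>m n n) (1\<^sub>m n)"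
    using M'(2) B B' by (simp add: mult_four_block)
  \<comment> \<open>The upper left block of \<open>M * M' = 1\<close> shows that the first block row
    of \<open>M\<close> is unimodular, as stable range one requires.\<close>
  then have "P * P' + Q * R' = 1\<^sub>m n" using B B' by (subst (asm) four_block_eq_iff[of _ n n _ n _ n]; simp)
  then obtain X where X: "X \<in> carrier_mat n n" and XG: "P * X + Q \<in> GL n"
    using stable_range_one[OF B(1,2) B'(1,3)] by blast
  define b where "b = P * X + Q"
  have b: "b \<in> GL n" unfolding b_def by (rule XG)
  obtain b' where b': "b' \<in> GL n" "b * b' = 1\<^sub>m n" "b' * b = 1\<^sub>m n" using GL_inverse[OF b] .
  obtain D' where D': "D' \<in> GL n" "D' * D = 1\<^sub>m n" using GL_inverse[OF D] by auto
  note c = B(1-4) X GL_carrier[OF b] GL_carrier[OF b'(1)] GL_carrier[OF D] GL_carrier[OF D'(1)]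
  \<comment> \<open>\<open>N\<close> is \<open>M\<close> times the inverse of the last factor; that
    inverse has the blocks \<open>D'\<close>, \<open>X\<close>, \<open>0\<close> and
    \<open>1\<close>.\<close>
  define a where "a = P * D'"
  define k where "k = R * D'"
  define d where "d = R * X + S"
  have acd: "a \<in> carrier_mat n n" "k \<in> carrier_mat n n" "d \<in> carrier_mat n n"
    unfolding a_def k_def d_def using c by auto
  note c = c acd
  define N where "N = four_block_mat a b k d"
  have N: "N \<in> carrier_mat (n + n) (n + n)" unfolding N_def using c by auto
  define A6 where "A6 = - (D * X)"
  have A6: "A6 \<in> carrier_mat n n" unfolding A6_def using c by auto
  have "a * A6 + b = Q" "k * A6 + d = S" unfolding a_def k_def b_def d_def A6_def
    using c by (simp_all add: mat_ring mat_cancel_left[OF D'(2)])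
      (auto intro!: eq_matI simp del: index_mult_mat(1))
  moreover have "a * D = P" "k * D = R" unfolding a_def k_def using c D'(2) by (simp_all add: mat_mult_assoc mat_one_right)
  ultimately have MN: "M = N * four_block_mat D A6 (0\<^sub>m n n) (1\<^sub>m n)"
    unfolding N_def B(5) using c A6 by (simp add: mult_four_block mat_one_right mat_zero_right)
  have "det M = det N * det D"
    unfolding MN using N c A6 det_mult[of N "n + n" "four_block_mat D A6 (0\<^sub>m n n) (1\<^sub>m n)"]
    by (simp add: det_four_block_mat_lower_left_zero[of D n A6 n])
  then have detN: "det N = 1" using det M by (simp add: GL_det)
  define s where "s = d * (b' * a) - k"
  have s: "s \<in> carrier_mat n n" unfolding s_def using c by (auto intro!: carrier_matI)
  \<comment> \<open>Exchanging the block columns would bring in a sign depending on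
    \<open>n\<close>; two shears reach a block triangular matrix with diagonal blocks
    \<open>b\<close> and \<open>s\<close> without one.\<close>
  let ?L = "four_block_mat (1\<^sub>m n) (0\<^sub>m n n) (1\<^sub>m n - b' * a) (1\<^sub>m n)"
  let ?U = "four_block_mat (1\<^sub>m n) (- 1\<^sub>m n) (0\<^sub>m n n) (1\<^sub>m n :: 'a mat)"
  have "a + b * (1\<^sub>m n - b' * a) = b" using c
    by (simp add: mat_ring mat_cancel_left[OF b'(2)]) (auto intro!: eq_matI simp del: index_mult_mat(1))
  moreover have "k + d * (1\<^sub>m n - b' * a) = d - s" unfolding s_def using c
    by (simp add: mat_ring) (auto intro!: eq_matI simp del: index_mult_mat(1))
  ultimately have "N * ?L = four_block_mat b b (d - s) d"
    unfolding N_def using c by (simp add: mult_four_block mat_one_right mat_zero_right)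
  also have "d - s + 0\<^sub>m n n = d - s" using c s by (intro right_add_zero_mat[of _ n n]) auto
  then have "four_block_mat b b (d - s) d * ?U = four_block_mat b (b * (- 1\<^sub>m n) + b) (d - s) ((d - s) * (- 1\<^sub>m n) + d)"
    using c s by (simp add: mult_four_block mat_one_right mat_zero_right)
  also have "b * (- 1\<^sub>m n) + b = 0\<^sub>m n n" using c by (simp add: mat_uminus_right mat_one_right uminus_l_inv_mat)
  also have "(d - s) * (- 1\<^sub>m n) + d = s" using c s by (auto simp: mat_uminus_right mat_one_right intro!: eq_matI)
  finally have NLU: "N * ?L * ?U = four_block_mat b (0\<^sub>m n n) (d - s) s" .
  have LU: "?L \<in> carrier_mat (n + n) (n + n)" "?U \<in> carrier_mat (n + n) (n + n)" using c by auto
  have "1\<^sub>m n - b' * a \<in> carrier_mat n n" using c by (intro carrier_matI) auto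
  then have "det ?L = 1" using c by (simp add: det_four_block_mat_upper_right_zero[of _ n _ n])
  moreover have "det ?U = 1" by (simp add: det_four_block_mat_lower_left_zero[of _ n _ n])
  ultimately have "det (N * ?L * ?U) = 1" using LU N detN by (simp add: det_mult[of _ "n + n"])
  moreover have "d - s \<in> carrier_mat n n" using c s by (intro carrier_matI) auto
  ultimately have "det b * det s = 1" unfolding NLU using c s
    by (simp add: det_four_block_mat_upper_right_zero[of b n _ n])
  then have h: "s * b \<in> carrier_mat n n" "det (s * b) = 1"
    using s c det_mult[OF s GL_carrier[OF b]] by (auto simp: mult.commute)
  obtain Y z W where "swap_factors n (s * b) Y z W" using swap_factors_exists[OF h n] by blast
  moreover have "s * b * b' = d * (b' * a) - k" using s c b'(2) unfolding s_def[symmetric]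
    by (simp add: mat_mult_assoc mat_one_right)
  ultimately obtain A1 A2 A3 A4 A5 where "A1 \<in> carrier_mat n n" "A2 \<in> carrier_mat n n" "A3 \<in> carrier_mat n n"
    "A4 \<in> carrier_mat n n" "A5 \<in> carrier_mat n n" "N =
      four_block_mat (1\<^sub>m n) (0\<^sub>m n n) A1 (1\<^sub>m n) * four_block_mat (1\<^sub>m n) A2 (0\<^sub>m n n) (1\<^sub>m n)
      * four_block_mat (1\<^sub>m n) (0\<^sub>m n n) A3 (1\<^sub>m n) * four_block_mat (1\<^sub>m n) A4 (0\<^sub>m n n) (1\<^sub>m n)
      * four_block_mat (1\<^sub>m n) (0\<^sub>m n n) A5 (1\<^sub>m n)"
    unfolding N_def using five_block_factors[OF _ h(1) acd b b'(2) GL_carrier[OF b'(1)]] by blast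
  then show ?thesis using MN A6 by blast
qed

section \<open>Five block factors do not suffice\<close>

definition diag_GL :: "nat \<Rightarrow> 'a::field mat set" where
  "diag_GL n = {B \<in> GL n. diagonal_mat B}"

lemma diag_GL_D:
  assumes "B \<in> diag_GL n"
  shows "B \<in> GL n" "B \<in> carrier_mat n n" "i < n \<Longrightarrow> j < n \<Longrightarrow> i \<noteq> j \<Longrightarrow> B $$ (i,j) = 0"
  using assms GL_carrier[of B n] unfolding diag_GL_def diagonal_mat_def by auto

lemma diag_GL_one: "1\<^sub>m n \<in> diag_GL n"
  by (auto simp: diag_GL_def diagonal_mat_def GL_one)

lemma diag_mult_index:
  fixes A :: "'a::field mat"
  assumes B: "B \<in> diag_GL n" and A: "A \<in> carrier_mat n k" and "i < n" "j < k"
  shows "(B * A) $$ (i,j) = B $$ (i,i) * A $$ (i,j)"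
proof -
  have "(B * A) $$ (i,j) = (\<Sum>l = 0..<n. B $$ (i,l) * A $$ (l,j))"
    using assms diag_GL_D(2)[OF B] by (simp add: scalar_prod_def)
  also have "\<dots> = (\<Sum>l = 0..<n. if l = i then B $$ (i,i) * A $$ (i,j) else 0)"
    using diag_GL_D(3)[OF B] assms by (intro sum.cong) auto
  finally show ?thesis using assms by simp
qed

lemma mult_diag_index:
  fixes A :: "'a::field mat"
  assumes B: "B \<in> diag_GL n" and A: "A \<in> carrier_mat k n" and "i < k" "j < n"
  shows "(A * B) $$ (i,j) = A $$ (i,j) * B $$ (j,j)"
proof -
  have "(A * B) $$ (i,j) = (\<Sum>l = 0..<n. A $$ (i,l) * B $$ (l,j))"
    using assms diag_GL_D(2)[OF B] by (simp add: scalar_prod_def)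
  also have "\<dots> = (\<Sum>l = 0..<n. if l = j then A $$ (i,j) * B $$ (j,j) else 0)"
    using diag_GL_D(3)[OF B] assms by (intro sum.cong) auto
  finally show ?thesis using assms by simp
qed

lemma diag_GL_mult:
  fixes A B :: "'a::field mat"
  assumes A: "A \<in> diag_GL n" and B: "B \<in> diag_GL n"
  shows "A * B \<in> diag_GL n"
proof -
  have "(A * B) $$ (i,j) = 0" if "i < n" "j < n" "i \<noteq> j" for i j
    using that diag_mult_index[OF A diag_GL_D(2)[OF B] that(1,2)] diag_GL_D(3)[OF B] by simp
  then show ?thesis
    using GL_mult[OF diag_GL_D(1)[OF A] diag_GL_D(1)[OF B]] diag_GL_D(2)[OF A] diag_GL_D(2)[OF B]
    by (auto simp: diag_GL_def diagonal_mat_def simp del: index_mult_mat(1))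
qed

lemma diag_GL_index:
  fixes B :: "'a::field mat"
  assumes B: "B \<in> diag_GL n" and i: "i < n"
  shows "B $$ (i,i) \<noteq> 0"
proof -
  have "upper_triangular B" using diag_GL_D[OF B] by (auto intro!: upper_triangularI)
  then show ?thesis using upper_triangular_GL_diag[OF diag_GL_D(1)[OF B] _ i] by blast
qed

lemma diag_GL_transpose:
  fixes B :: "'a::field mat"
  assumes "B \<in> diag_GL n"
  shows "transpose_mat B \<in> diag_GL n"
  using assms diag_GL_D[OF assms] by (auto simp: diag_GL_def diagonal_mat_def GL_det det_transpose)

lemma diag_GL_inverse:
  fixes B :: "'a::field mat"
  assumes B: "B \<in> diag_GL n"
  obtains B' where "B' \<in> diag_GL n" "B * B' = 1\<^sub>m n" "B' * B = 1\<^sub>m n"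
proof -
  obtain B' where B': "B' \<in> GL n" "B * B' = 1\<^sub>m n" "B' * B = 1\<^sub>m n" using GL_inverse[OF diag_GL_D(1)[OF B]] .
  have "B' $$ (i,j) = 0" if "i < n" "j < n" "i \<noteq> j" for i j
    using diag_mult_index[OF B GL_carrier[OF B'(1)] that(1,2)] B'(2) that diag_GL_index[OF B that(1)] by simp
  then have "B' \<in> diag_GL n" using B'(1) GL_carrier[OF B'(1)] by (auto simp: diag_GL_def diagonal_mat_def)
  then show thesis using that B' by blast
qed

section \<open>Words in block triangular matrices\<close>

definition tri_block :: "bool \<Rightarrow> nat \<Rightarrow> nat \<Rightarrow> 'a::field mat set" where
  "tri_block low m n = (if low
    then {four_block_mat B (0\<^sub>m m n) A C | A B C. A \<in> carrier_mat n m \<and> B \<in> diag_GL m \<and> C \<in> diag_GL n}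
    else {four_block_mat B A (0\<^sub>m n m) C | A B C. A \<in> carrier_mat m n \<and> B \<in> diag_GL m \<and> C \<in> diag_GL n})"

lemma T_set_tri_block: "T_set m n = tri_block True m n \<union> tri_block False m n"
  unfolding T_set_def tri_block_def diag_GL_def by auto

lemma tri_block_carrier: "x \<in> tri_block s m n \<Longrightarrow> x \<in> carrier_mat (m + n) (m + n)"
  by (auto simp: tri_block_def split: if_splits intro!: four_block_carrier_mat dest: diag_GL_D(2))

lemma tri_blockI:
  assumes "B \<in> diag_GL m" "C \<in> diag_GL n"
  shows "A \<in> carrier_mat n m \<Longrightarrow> four_block_mat B (0\<^sub>m m n) A C \<in> tri_block True m n"
    and "A \<in> carrier_mat m n \<Longrightarrow> four_block_mat B A (0\<^sub>m n m) C \<in> tri_block False m n"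
  using assms by (auto simp: tri_block_def)

lemma tri_block_one: "1\<^sub>m (m + n) \<in> tri_block s m n"
  unfolding one_four_block using tri_blockI(1)[OF diag_GL_one diag_GL_one zero_carrier_mat, of m n]
    tri_blockI(2)[OF diag_GL_one diag_GL_one zero_carrier_mat, of m n] by (cases s) simp_all

lemma tri_block_mult:
  fixes x y :: "'a::field mat"
  assumes "x \<in> tri_block s m n" "y \<in> tri_block s m n"
  shows "x * y \<in> tri_block s m n"
proof (cases s)
  case True
  with assms obtain A B C A' B' C' where *: "x = four_block_mat B (0\<^sub>m m n) A C" "A \<in> carrier_mat n m"
    "B \<in> diag_GL m" "C \<in> diag_GL n" "y = four_block_mat B' (0\<^sub>m m n) A' C'" "A' \<in> carrier_mat n m"
    "B' \<in> diag_GL m" "C' \<in> diag_GL n" unfolding tri_block_def by auto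
  note c = *(2,6) diag_GL_D(2)[OF *(3)] diag_GL_D(2)[OF *(4)] diag_GL_D(2)[OF *(7)] diag_GL_D(2)[OF *(8)]
  have "x * y = four_block_mat (B * B') (0\<^sub>m m n) (A * B' + C * A') (C * C')"
    unfolding *(1,5) using c by (simp add: mult_four_block mat_zero_left mat_zero_right)
  moreover have "A * B' + C * A' \<in> carrier_mat n m" using c by auto
  ultimately show ?thesis
    using True tri_blockI(1)[OF diag_GL_mult[OF *(3,7)] diag_GL_mult[OF *(4,8)]] by simp
next
  case False
  with assms obtain A B C A' B' C' where *: "x = four_block_mat B A (0\<^sub>m n m) C" "A \<in> carrier_mat m n"
    "B \<in> diag_GL m" "C \<in> diag_GL n" "y = four_block_mat B' A' (0\<^sub>m n m) C'" "A' \<in> carrier_mat m n"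
    "B' \<in> diag_GL m" "C' \<in> diag_GL n" unfolding tri_block_def by auto
  note c = *(2,6) diag_GL_D(2)[OF *(3)] diag_GL_D(2)[OF *(4)] diag_GL_D(2)[OF *(7)] diag_GL_D(2)[OF *(8)]
  have "x * y = four_block_mat (B * B') (B * A' + A * C') (0\<^sub>m n m) (C * C')"
    unfolding *(1,5) using c by (simp add: mult_four_block mat_zero_left mat_zero_right)
  moreover have "B * A' + A * C' \<in> carrier_mat m n" using c by auto
  ultimately show ?thesis
    using False tri_blockI(2)[OF diag_GL_mult[OF *(3,7)] diag_GL_mult[OF *(4,8)]] by simp
qed

lemma tri_block_transpose:
  fixes x :: "'a::field mat"
  assumes "x \<in> tri_block s m n"
  shows "transpose_mat x \<in> tri_block (\<not> s) m n"
proof (cases s)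
  case True
  with assms obtain A B C where *: "x = four_block_mat B (0\<^sub>m m n) A C" "A \<in> carrier_mat n m"
    "B \<in> diag_GL m" "C \<in> diag_GL n" unfolding tri_block_def by auto
  have "transpose_mat x = four_block_mat (transpose_mat B) (transpose_mat A) (0\<^sub>m n m) (transpose_mat C)"
    unfolding *(1) using *(2) diag_GL_D(2)[OF *(3)] diag_GL_D(2)[OF *(4)]
    by (simp add: transpose_four_block_mat[of _ m m _ n _ n])
  then show ?thesis
    using True *(2) tri_blockI(2)[OF diag_GL_transpose[OF *(3)] diag_GL_transpose[OF *(4)]] by simp
next
  case False
  with assms obtain A B C where *: "x = four_block_mat B A (0\<^sub>m n m) C" "A \<in> carrier_mat m n"
    "B \<in> diag_GL m" "C \<in> diag_GL n" unfolding tri_block_def by auto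
  have "transpose_mat x = four_block_mat (transpose_mat B) (0\<^sub>m m n) (transpose_mat A) (transpose_mat C)"
    unfolding *(1) using *(2) diag_GL_D(2)[OF *(3)] diag_GL_D(2)[OF *(4)]
    by (simp add: transpose_four_block_mat[of _ m m _ n _ n])
  then show ?thesis
    using False *(2) tri_blockI(1)[OF diag_GL_transpose[OF *(3)] diag_GL_transpose[OF *(4)]] by simp
qed

text \<open>The flag is the orientation of the last factor, because words grow on the right as in
  \<open>mat_set_power\<close>.\<close>

fun alternating :: "bool \<Rightarrow> nat \<Rightarrow> nat \<Rightarrow> nat \<Rightarrow> 'a::field mat set" where
  "alternating s m n 0 = {1\<^sub>m (m + n)}"
| "alternating s m n (Suc k) = {P * x | P x. P \<in> alternating (\<not> s) m n k \<and> x \<in> tri_block s m n}"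

lemma alternating_carrier: "x \<in> alternating s m n k \<Longrightarrow> x \<in> carrier_mat (m + n) (m + n)"
  by (induction k arbitrary: s x) (auto dest!: tri_block_carrier intro!: mult_carrier_mat[of _ _ "m + n"])

text \<open>Neighbours of equal orientation merge into one factor, and the word regains its length
  by an identity, which has both orientations.\<close>

lemma T_set_power_alternating:
  "mat_set_power (m + n) (T_set m n) k \<subseteq> (alternating True m n k \<union> alternating False m n k :: 'a::field mat set)"
proof (induction k)
  case 0
  then show ?case by simp
next
  case (Suc k)
  show ?case
  proof
    fix M :: "'a mat" assume "M \<in> mat_set_power (m + n) (T_set m n) (Suc k)"
    then obtain P x where M: "M = P * x" "P \<in> mat_set_power (m + n) (T_set m n) k" "x \<in> T_set m n" by auto
    from M(3) obtain s where s: "x \<in> tri_block s m n" unfolding T_set_tri_block by blast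
    from M(2) Suc obtain t where t: "P \<in> alternating t m n k" by blast
    have "\<exists>r. M \<in> alternating r m n (Suc k)"
    proof (cases "t = (\<not> s)")
      case True
      then show ?thesis using t s M(1) by auto
    next
      case False
      then have ts: "t = s" by auto
      show ?thesis
      proof (cases k)
        case 0
        then show ?thesis using t s M(1) by auto
      next
        case (Suc k')
        then obtain Q y where Q: "P = Q * y" "Q \<in> alternating (\<not> s) m n k'" "y \<in> tri_block s m n"
          using t ts by auto
        have "M = Q * (y * x)" unfolding M(1) Q(1)
          using alternating_carrier[OF Q(2)] tri_block_carrier[OF Q(3)] tri_block_carrier[OF s]
          by (simp add: mat_mult_assoc)
        then have Mk: "M \<in> alternating s m n k" using Q(2) tri_block_mult[OF Q(3) s] Suc by auto
        have "M = M * 1\<^sub>m (m + n)" using alternating_carrier[OF Mk] by (simp add: mat_one_right)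
        then have "M \<in> alternating (\<not> s) m n (Suc k)" using Mk tri_block_one[of m n "\<not> s"] by auto
        then show ?thesis by blast
      qed
    qed
    then show "M \<in> alternating True m n (Suc k) \<union> alternating False m n (Suc k)" by (metis (full_types) UnI1 UnI2)
  qed
qed

text \<open>What remains of a lower-upper-lower-upper-lower factorisation of the block diagonal matrix
  of \<open>a\<close> and \<open>d\<close>: here \<open>q\<close> and \<open>p\<close> are the off-diagonal blocks of the third and fourth factor.\<close>

definition five_obstruction :: "nat \<Rightarrow> nat \<Rightarrow> 'a::field mat \<Rightarrow> 'a mat \<Rightarrow> bool" where
  "five_obstruction m n a d \<longleftrightarrow> (\<exists>\<beta> \<in> diag_GL m. \<exists>\<beta>' \<in> diag_GL m. \<exists>\<gamma> \<in> diag_GL n. \<exists>\<gamma>' \<in> diag_GL n. \<exists>\<delta> \<in> diag_GL n.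
    \<exists>p \<in> carrier_mat m n. \<exists>q \<in> carrier_mat n m. \<exists>w' \<in> carrier_mat n n.
      (\<delta> + q * p) * w' = 1\<^sub>m n \<and> a = \<beta> * (1\<^sub>m m - p * w' * q) * \<beta>' \<and> d = \<gamma> * (\<delta> + q * p) * \<gamma>')"

text \<open>The outer lower factors change the upper right block only by invertible diagonal
  factors, so it vanishes already for the inner three; call it \<open>q12\<close>. Then
  \<open>d\<close> is \<open>w\<close> up to diagonal factors, hence \<open>w\<close> is invertible,
  and \<open>q12 = 0\<close> can be solved for \<open>A2\<close>, which turns \<open>a\<close> into
  the stated expression.\<close>

lemma five_obstructionI:
  fixes a d :: "'a::field mat"
  assumes a: "a \<in> carrier_mat m m" and d: "d \<in> GL n"
    and x: "x1 \<in> tri_block True m n" "x2 \<in> tri_block False m n" "x3 \<in> tri_block True m n"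
      "x4 \<in> tri_block False m n" "x5 \<in> tri_block True m n"
    and eq: "four_block_mat a (0\<^sub>m m n) (0\<^sub>m n m) d = x1 * (x2 * (x3 * x4)) * x5"
  shows "five_obstruction m n a d"
proof -
  obtain A1 B1 C1 where x1: "x1 = four_block_mat B1 (0\<^sub>m m n) A1 C1" "A1 \<in> carrier_mat n m" "B1 \<in> diag_GL m" "C1 \<in> diag_GL n"
    using x(1) unfolding tri_block_def by auto
  obtain A2 B2 C2 where x2: "x2 = four_block_mat B2 A2 (0\<^sub>m n m) C2" "A2 \<in> carrier_mat m n" "B2 \<in> diag_GL m" "C2 \<in> diag_GL n"
    using x(2) unfolding tri_block_def by auto
  obtain A3 B3 C3 where x3: "x3 = four_block_mat B3 (0\<^sub>m m n) A3 C3" "A3 \<in> carrier_mat n m" "B3 \<in> diag_GL m" "C3 \<in> diag_GL n"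
    using x(3) unfolding tri_block_def by auto
  obtain A4 B4 C4 where x4: "x4 = four_block_mat B4 A4 (0\<^sub>m n m) C4" "A4 \<in> carrier_mat m n" "B4 \<in> diag_GL m" "C4 \<in> diag_GL n"
    using x(4) unfolding tri_block_def by auto
  obtain A5 B5 C5 where x5: "x5 = four_block_mat B5 (0\<^sub>m m n) A5 C5" "A5 \<in> carrier_mat n m" "B5 \<in> diag_GL m" "C5 \<in> diag_GL n"
    using x(5) unfolding tri_block_def by auto
  note c = a GL_carrier[OF d] x1(2) x2(2) x3(2) x4(2) x5(2)
    diag_GL_D(2)[OF x1(3)] diag_GL_D(2)[OF x2(3)] diag_GL_D(2)[OF x3(3)] diag_GL_D(2)[OF x4(3)] diag_GL_D(2)[OF x5(3)]
    diag_GL_D(2)[OF x1(4)] diag_GL_D(2)[OF x2(4)] diag_GL_D(2)[OF x3(4)] diag_GL_D(2)[OF x4(4)] diag_GL_D(2)[OF x5(4)]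
  define w where "w = C3 * C4 + A3 * A4"
  have w: "w \<in> carrier_mat n n" unfolding w_def using c by auto
  have x34: "x3 * x4 = four_block_mat (B3 * B4) (B3 * A4) (A3 * B4) w"
    unfolding x3(1) x4(1) w_def using c by (simp add: mult_four_block mat_zero_left mat_zero_right comm_add_mat[of _ n n])
  define q11 where "q11 = B2 * (B3 * B4) + A2 * (A3 * B4)"
  define q12 where "q12 = B2 * (B3 * A4) + A2 * w"
  have q: "q11 \<in> carrier_mat m m" "q12 \<in> carrier_mat m n" unfolding q11_def q12_def using c w by auto
  have x234: "x2 * (x3 * x4) = four_block_mat q11 q12 (C2 * (A3 * B4)) (C2 * w)"
    unfolding x34 x2(1) q11_def q12_def using c w by (simp add: mult_four_block mat_zero_left)
  define r where "r = A1 * q12 + C1 * (C2 * w)"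
  define l where "l = A1 * q11 + C1 * (C2 * (A3 * B4))"
  have rl: "r \<in> carrier_mat n n" "l \<in> carrier_mat n m" unfolding r_def l_def using c w q by auto
  have "x1 * (x2 * (x3 * x4)) = four_block_mat (B1 * q11) (B1 * q12) l r"
    unfolding x234 x1(1) r_def l_def using c w q by (simp add: mult_four_block mat_zero_left)
  then have "x1 * (x2 * (x3 * x4)) * x5 = four_block_mat (B1 * q11 * B5 + B1 * q12 * A5) (B1 * q12 * C5)
      (l * B5 + r * A5) (r * C5)"
    unfolding x5(1) using c w q rl by (simp add: mult_four_block mat_zero_right)
  then have e: "four_block_mat a (0\<^sub>m m n) (0\<^sub>m n m) d = four_block_mat (B1 * q11 * B5 + B1 * q12 * A5) (B1 * q12 * C5)
      (l * B5 + r * A5) (r * C5)" unfolding eq .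
  have "a = B1 * q11 * B5 + B1 * q12 * A5 \<and> 0\<^sub>m m n = B1 * q12 * C5 \<and> 0\<^sub>m n m = l * B5 + r * A5 \<and> d = r * C5"
    by (rule four_block_eq_iff[of _ m m _ n _ n, THEN iffD1, OF _ _ _ _ _ _ _ _ e]) (use c w q rl in auto)
  then have e: "a = B1 * q11 * B5 + B1 * q12 * A5" "0\<^sub>m m n = B1 * q12 * C5" "d = r * C5" by auto
  obtain B1' where B1': "B1' \<in> diag_GL m" "B1' * B1 = 1\<^sub>m m" using diag_GL_inverse[OF x1(3)] by blast
  obtain C5' where C5': "C5' \<in> diag_GL n" "C5 * C5' = 1\<^sub>m n" using diag_GL_inverse[OF x5(4)] by blast
  note c = c w q diag_GL_D(2)[OF B1'(1)] diag_GL_D(2)[OF C5'(1)]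
  have "B1' * (B1 * q12 * C5) * C5' = q12"
    using c by (simp add: mat_mult_assoc mat_cancel_left[OF B1'(2)] C5'(2) mat_one_right)
  then have q12: "q12 = 0\<^sub>m m n" unfolding e(2)[symmetric] using c by (simp add: mat_zero_left mat_zero_right)
  have d_eq: "d = C1 * C2 * w * C5" unfolding e(3) r_def q12 using c by (simp add: mat_zero_right mat_mult_assoc)
  have "det d = det (C1 * C2) * det w * det C5" unfolding d_eq using c by (simp add: det_mult[of _ n])
  then have "w \<in> GL n" using d w by (auto simp: GL_det)
  then obtain w' where w': "w' \<in> GL n" "w * w' = 1\<^sub>m n" using GL_inverse by blast
  note c = c GL_carrier[OF w'(1)]
  have "A2 = A2 * w * w'" using c w' by (simp add: mat_mult_assoc mat_one_right)
  also have "A2 * w = q12 - B2 * (B3 * A4)" unfolding q12_def using c by (intro eq_matI; simp del: index_mult_mat(1))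
  also have "\<dots> * w' = - (B2 * B3 * A4 * w')" unfolding q12 using c
    by (simp add: mat_ring) (intro eq_matI; simp del: index_mult_mat(1))
  finally have A2: "A2 = - (B2 * B3 * A4 * w')" .
  have "B1 * q11 * B5 \<in> carrier_mat m m" using c by auto
  then have a_eq: "a = B1 * q11 * B5" unfolding e(1) q12 using c by (simp add: mat_zero_left mat_zero_right)
  have "q11 = B2 * B3 * (1\<^sub>m m - A4 * w' * A3) * B4" unfolding q11_def A2 using c
    by (simp add: mat_ring) (intro eq_matI; simp del: index_mult_mat(1))
  then have "a = B1 * (B2 * B3) * (1\<^sub>m m - A4 * w' * A3) * (B4 * B5)"
    unfolding a_eq using c by (simp add: mat_mult_assoc)
  moreover have "B1 * (B2 * B3) \<in> diag_GL m" "B4 * B5 \<in> diag_GL m" "C1 * C2 \<in> diag_GL n" "C3 * C4 \<in> diag_GL n"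
    using x1 x2 x3 x4 x5 by (simp_all add: diag_GL_mult)
  ultimately show ?thesis unfolding five_obstruction_def
    using d_eq w'(2) x4(2) x3(2) GL_carrier[OF w'(1)] x5(4) unfolding w_def by blast
qed

text \<open>A word of odd length has the same orientation at both ends. Transposition reverses the
  word and flips each factor, so a word with upper ends becomes one with lower ends.\<close>

lemma five_obstruction_of_power:
  fixes a d :: "'a::field mat"
  assumes a: "a \<in> carrier_mat m m" and d: "d \<in> GL n"
    and M: "four_block_mat a (0\<^sub>m m n) (0\<^sub>m n m) d \<in> mat_set_power (m + n) (T_set m n) 5"
  shows "five_obstruction m n a d \<or> five_obstruction m n (transpose_mat a) (transpose_mat d)"
proof -
  obtain s where "four_block_mat a (0\<^sub>m m n) (0\<^sub>m n m) d \<in> alternating s m n 5"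
    using M T_set_power_alternating[of m n 5, where 'a='a] by blast
  then obtain x1 x2 x3 x4 x5 where x: "x1 \<in> tri_block s m n" "x2 \<in> tri_block (\<not> s) m n" "x3 \<in> tri_block s m n"
      "x4 \<in> tri_block (\<not> s) m n" "x5 \<in> tri_block s m n"
    and eq: "four_block_mat a (0\<^sub>m m n) (0\<^sub>m n m) d = 1\<^sub>m (m + n) * x1 * x2 * x3 * x4 * x5"
    by (auto simp: numeral_eq_Suc)
  note c = x[THEN tri_block_carrier]
  show ?thesis
  proof (cases s)
    case True
    then show ?thesis using five_obstructionI[OF a d, of x1 x2 x3 x4 x5] x eq c
      by (simp add: mat_mult_assoc mat_one_left)
  next
    case False
    have dT: "transpose_mat d \<in> GL n" using d GL_carrier[OF d] by (simp add: GL_det det_transpose)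
    have "transpose_mat (four_block_mat a (0\<^sub>m m n) (0\<^sub>m n m) d)
        = transpose_mat x5 * (transpose_mat x4 * (transpose_mat x3 * transpose_mat x2)) * transpose_mat x1"
      unfolding eq using c by (simp add: mat_one_left transpose_mult[of _ "m + n" "m + n" _ "m + n"] mat_mult_assoc)
    moreover have "transpose_mat (four_block_mat a (0\<^sub>m m n) (0\<^sub>m n m) d)
        = four_block_mat (transpose_mat a) (0\<^sub>m m n) (0\<^sub>m n m) (transpose_mat d)"
      using a GL_carrier[OF d] by (simp add: transpose_four_block_mat[of _ m m _ n _ n])
    ultimately show ?thesis
      using five_obstructionI[of "transpose_mat a" m "transpose_mat d" n "transpose_mat x5" "transpose_mat x4"
          "transpose_mat x3" "transpose_mat x2" "transpose_mat x1"] a dT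
        x[THEN tri_block_transpose] False by simp
  qed
qed

section \<open>Trace and rank obstructions\<close>

definition mat_trace :: "'a::comm_ring_1 mat \<Rightarrow> 'a" where
  "mat_trace A = (\<Sum>i = 0..<dim_row A. A $$ (i,i))"

lemma mat_trace_comm:
  fixes A :: "'a::comm_ring_1 mat"
  assumes "A \<in> carrier_mat m n" "B \<in> carrier_mat n m"
  shows "mat_trace (A * B) = mat_trace (B * A)"
proof -
  have "mat_trace (A * B) = (\<Sum>i = 0..<m. \<Sum>j = 0..<n. A $$ (i,j) * B $$ (j,i))"
    using assms by (simp add: mat_trace_def scalar_prod_def)
  also have "\<dots> = (\<Sum>j = 0..<n. \<Sum>i = 0..<m. B $$ (j,i) * A $$ (i,j))"
    by (subst sum.swap) (simp add: mult.commute)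
  also have "\<dots> = mat_trace (B * A)" using assms by (simp add: mat_trace_def scalar_prod_def)
  finally show ?thesis .
qed

text \<open>Cyclicity of the trace turns \<open>tr (p * w\<^sup>-\<^sup>1 * q)\<close> into \<open>tr (w\<^sup>-\<^sup>1 * (w - \<delta>))\<close>.\<close>

lemma five_obstruction_trace:
  fixes a d :: "'a::field mat"
  assumes ob: "five_obstruction m n a d" and d': "d' \<in> carrier_mat n n" "d * d' = 1\<^sub>m n"
    and a: "a \<in> carrier_mat m m" "\<And>i. i < m \<Longrightarrow> a $$ (i,i) = 0"
  shows "\<exists>g. (\<forall>j<n. g j \<noteq> 0) \<and> of_nat m + (\<Sum>j = 0..<n. g j * d' $$ (j,j)) = of_nat n"
proof -
  obtain \<beta> \<beta>' \<gamma> \<gamma>' \<delta> p q w' where o: "\<beta> \<in> diag_GL m" "\<beta>' \<in> diag_GL m" "\<gamma> \<in> diag_GL n" "\<gamma>' \<in> diag_GL n"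
    "\<delta> \<in> diag_GL n" "p \<in> carrier_mat m n" "q \<in> carrier_mat n m" "w' \<in> carrier_mat n n"
    and e: "(\<delta> + q * p) * w' = 1\<^sub>m n" "a = \<beta> * (1\<^sub>m m - p * w' * q) * \<beta>'" "d = \<gamma> * (\<delta> + q * p) * \<gamma>'"
    using ob unfolding five_obstruction_def by blast
  define w where "w = \<delta> + q * p"
  obtain \<beta>i where \<beta>i: "\<beta>i \<in> diag_GL m" "\<beta>i * \<beta> = 1\<^sub>m m" using diag_GL_inverse[OF o(1)] by blast
  obtain \<beta>j where \<beta>j: "\<beta>j \<in> diag_GL m" "\<beta>' * \<beta>j = 1\<^sub>m m" using diag_GL_inverse[OF o(2)] by blast
  note c = o(6-8) d'(1) a(1) o(1-5)[THEN diag_GL_D(2)] \<beta>i(1)[THEN diag_GL_D(2)] \<beta>j(1)[THEN diag_GL_D(2)]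
  have w: "w \<in> carrier_mat n n" unfolding w_def using c by auto
  have ww': "w * w' = 1\<^sub>m n" unfolding w_def by (rule e(1))
  then have w'w: "w' * w = 1\<^sub>m n" using mat_mult_left_right_inverse[OF w o(8)] by blast
  have dd: "d \<in> carrier_mat n n" unfolding e(3) using c by auto
  have d'd: "d' * d = 1\<^sub>m n" using mat_mult_left_right_inverse[OF dd d'] .
  have w'_eq: "w' = \<gamma>' * d' * \<gamma>"
  proof -
    obtain \<gamma>j where \<gamma>j: "\<gamma>j \<in> diag_GL n" "\<gamma>' * \<gamma>j = 1\<^sub>m n" using diag_GL_inverse[OF o(4)] by blast
    have "\<gamma>' * d' * \<gamma> * w = \<gamma>' * (d' * d) * \<gamma>j"
      unfolding e(3) w_def[symmetric] using c w diag_GL_D(2)[OF \<gamma>j(1)]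
      by (simp add: mat_mult_assoc \<gamma>j(2) mat_one_right)
    also have "\<dots> = 1\<^sub>m n" unfolding d'd using c \<gamma>j(2) by (simp add: mat_one_right)
    finally have 1: "\<gamma>' * d' * \<gamma> * w = 1\<^sub>m n" .
    have "w' = \<gamma>' * d' * \<gamma> * w * w'" unfolding 1 using c by (simp add: mat_one_left)
    also have "\<dots> = \<gamma>' * d' * \<gamma> * (w * w')" using c w by (simp add: mat_mult_assoc)
    also have "\<dots> = \<gamma>' * d' * \<gamma>" unfolding ww' using c by (simp add: mat_one_right)
    finally show ?thesis .
  qed
  \<comment> \<open>The unknown diagonal factors enter the final identity only through these
    products, of which only non-vanishing is known.\<close>
  define g where "g j = \<gamma>' $$ (j,j) * \<gamma> $$ (j,j) * \<delta> $$ (j,j)" for j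
  have g: "g j \<noteq> 0" if "j < n" for j unfolding g_def
    using diag_GL_index[OF o(4) that] diag_GL_index[OF o(3) that] diag_GL_index[OF o(5) that] by simp
  \<comment> \<open>Diagonal factors preserve the zero diagonal of \<open>a\<close>, so
    \<open>p * w' * q\<close> has ones on its diagonal and trace \<open>m\<close>.\<close>
  have "\<beta>i * a * \<beta>j = 1\<^sub>m m - p * (w' * q)" unfolding e(2) using c
    by (simp add: mat_mult_assoc mat_cancel_left[OF \<beta>i(2)] \<beta>j(2) mat_one_right)
  moreover have "(\<beta>i * a * \<beta>j) $$ (i,i) = 0" if "i < m" for i
    using that c a(2) by (simp add: mult_diag_index[OF \<beta>j(1), of _ m] diag_mult_index[OF \<beta>i(1), of _ m] del: index_mult_mat(1))
  ultimately have "(1\<^sub>m m - p * (w' * q)) $$ (i,i) = 0" if "i < m" for i using that by simp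
  then have "(p * (w' * q)) $$ (i,i) = 1" if "i < m" for i using that c by (simp del: index_mult_mat(1))
  then have "mat_trace (p * (w' * q)) = of_nat m" using c by (simp add: mat_trace_def del: index_mult_mat(1))
  also have "mat_trace (p * (w' * q)) = mat_trace (w' * q * p)" using c by (intro mat_trace_comm) auto
  also have "w' * q * p = 1\<^sub>m n - w' * \<delta>"
  proof -
    have "w' * q * p = w' * w - w' * \<delta>" unfolding w_def using c
      by (simp add: mat_ring) (intro eq_matI; simp del: index_mult_mat(1))
    then show ?thesis unfolding w'w .
  qed
  also have "mat_trace \<dots> = (\<Sum>j = 0..<n. 1 - g j * d' $$ (j,j))"
  proof -
    have "(w' * \<delta>) $$ (j,j) = g j * d' $$ (j,j)" if "j < n" for j
      unfolding w'_eq g_def using that c o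
      by (simp add: mult_diag_index[of _ n _ n] diag_mult_index[of _ n _ n] del: index_mult_mat(1))
    then show ?thesis using c by (simp add: mat_trace_def del: index_mult_mat(1))
  qed
  also have "\<dots> = of_nat n - (\<Sum>j = 0..<n. g j * d' $$ (j,j))" by (simp add: sum_subtractf)
  finally have "of_nat m + (\<Sum>j = 0..<n. g j * d' $$ (j,j)) = of_nat n" by (simp add: algebra_simps)
  then show ?thesis using g by blast
qed

text \<open>Off the diagonal the entries are products of an entry of \<open>u\<close> and one of
  \<open>v\<close>; the two given entries make the \<open>i\<close>-th of \<open>u\<close> and the
  \<open>k\<close>-th of \<open>v\<close> non-zero.\<close>

lemma diag_plus_rank_one_pattern:
  fixes u v :: "'a::field mat"
  assumes \<Delta>: "\<Delta> \<in> diag_GL n" and u: "u \<in> carrier_mat n 1" and v: "v \<in> carrier_mat 1 n"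
    and ijk: "i < n" "j < n" "k < n" "i \<noteq> j" "j \<noteq> k" "i \<noteq> k"
    and nz: "(\<Delta> + u * v) $$ (i,j) \<noteq> 0" "(\<Delta> + u * v) $$ (j,k) \<noteq> 0"
  shows "(\<Delta> + u * v) $$ (i,k) \<noteq> 0"
proof -
  have "(\<Delta> + u * v) $$ (i,j) = u $$ (i,0) * v $$ (0,j)" if "i < n" "j < n" "i \<noteq> j" for i j
    using that u v diag_GL_D[OF \<Delta>] by (simp add: scalar_prod_def One_nat_def)
  then show ?thesis using ijk nz by auto
qed

text \<open>For \<open>m = 1\<close> the product \<open>q * p\<close> has rank at most one, and
  diagonal factors preserve the shape. For \<open>n = 1\<close> it is \<open>p * w' * q\<close> that
  does, so the test moves from \<open>d\<close> to \<open>a\<close>.\<close>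

lemma five_obstruction_row:
  fixes a d :: "'a::field mat"
  assumes ob: "five_obstruction 1 n a d" and ijk: "i < n" "j < n" "k < n" "i \<noteq> j" "j \<noteq> k" "i \<noteq> k"
    and nz: "d $$ (i,j) \<noteq> 0" "d $$ (j,k) \<noteq> 0"
  shows "d $$ (i,k) \<noteq> 0"
proof -
  obtain \<gamma> \<gamma>' \<delta> p q where o: "\<gamma> \<in> diag_GL n" "\<gamma>' \<in> diag_GL n"
    "\<delta> \<in> diag_GL n" "p \<in> carrier_mat 1 n" "q \<in> carrier_mat n 1" and e: "d = \<gamma> * (\<delta> + q * p) * \<gamma>'"
    using ob unfolding five_obstruction_def by blast
  note c = o(4,5) o(1-3)[THEN diag_GL_D(2)]
  have d: "d = \<gamma> * \<delta> * \<gamma>' + (\<gamma> * q) * (p * \<gamma>')" unfolding e using c by (simp add: mat_ring)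
  have "\<gamma> * \<delta> * \<gamma>' \<in> diag_GL n" using o by (simp add: diag_GL_mult)
  then show ?thesis using diag_plus_rank_one_pattern[of "\<gamma> * \<delta> * \<gamma>'" n "\<gamma> * q" "p * \<gamma>'" i j k] ijk nz c
    unfolding d by simp
qed

lemma five_obstruction_column:
  fixes a d :: "'a::field mat"
  assumes ob: "five_obstruction m 1 a d" and ijk: "i < m" "j < m" "k < m" "i \<noteq> j" "j \<noteq> k" "i \<noteq> k"
    and nz: "a $$ (i,j) \<noteq> 0" "a $$ (j,k) \<noteq> 0"
  shows "a $$ (i,k) \<noteq> 0"
proof -
  obtain \<beta> \<beta>' p q w' where o: "\<beta> \<in> diag_GL m" "\<beta>' \<in> diag_GL m"
    "p \<in> carrier_mat m 1" "q \<in> carrier_mat 1 m" "w' \<in> carrier_mat 1 1" and e: "a = \<beta> * (1\<^sub>m m - p * w' * q) * \<beta>'"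
    using ob unfolding five_obstruction_def by blast
  note c = o(3-5) o(1,2)[THEN diag_GL_D(2)]
  have a: "a = \<beta> * \<beta>' + (- (\<beta> * (p * w'))) * (q * \<beta>')" unfolding e using c
    by (simp add: mat_ring) (intro eq_matI; simp del: index_mult_mat(1))
  have "\<beta> * \<beta>' \<in> diag_GL m" using o by (simp add: diag_GL_mult)
  then show ?thesis using diag_plus_rank_one_pattern[of "\<beta> * \<beta>'" m "- (\<beta> * (p * w'))" "q * \<beta>'" i j k] ijk nz c
    unfolding a by simp
qed

section \<open>Matrices of determinant one outside the fifth power\<close>

lemma five_factors_fail_row:
  assumes n: "n \<ge> 3"
  shows "\<exists>M \<in> SL (1 + n) :: 'a::field mat set. M \<notin> mat_set_power (1 + n) (T_set 1 n) 5"
proof -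
  define C where "C = (cycle_mat n :: 'a mat)"
  define a where "a = mat 1 1 (\<lambda>_. inverse (det C))"
  have ind: "C $$ (i,j) = (if i = Suc j mod n then 1 else 0)" if "i < n" "j < n" for i j
    unfolding C_def using that by (simp add: cycle_mat_def)
  have C: "C \<in> GL n" "C \<in> carrier_mat n n" "det C \<noteq> 0" using cycle_mat_GL[of n, where 'a='a] by (simp_all add: C_def GL_det)
  have a: "a \<in> carrier_mat 1 1" "det a = inverse (det C)" by (simp_all add: a_def det_single)
  let ?M = "four_block_mat a (0\<^sub>m 1 n) (0\<^sub>m n 1) C"
  have "det ?M = 1" using C a by (simp add: det_four_block_mat_upper_right_zero[of a 1 _ n])
  then have "?M \<in> SL (1 + n)" using C a by (auto simp: SL_def GL_det)
  moreover have "?M \<notin> mat_set_power (1 + n) (T_set 1 n) 5"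
  proof
    assume "?M \<in> mat_set_power (1 + n) (T_set 1 n) 5"
    then consider "five_obstruction 1 n a C" | "five_obstruction 1 n (transpose_mat a) (transpose_mat C)"
      using five_obstruction_of_power[OF a(1) C(1)] by blast
    then show False
    proof cases
      case 1
      \<comment> \<open>The positions \<open>(2,1)\<close> and \<open>(1,0)\<close> belong to the
        cycle, \<open>(2,0)\<close> does not. For the transpose the order of the three indices is
        reversed.\<close>
      from five_obstruction_row[OF this, of 2 1 0] n show False by (simp add: ind One_nat_def)
    next
      case 2
      from five_obstruction_row[OF this, of 0 1 2] n C(2) show False by (simp add: ind One_nat_def)
    qed
  qed
  ultimately show ?thesis by blast
qed

lemma five_factors_fail_column:
  assumes m: "m \<ge> 3"
  shows "\<exists>M \<in> SL (m + 1) :: 'a::field mat set. M \<notin> mat_set_power (m + 1) (T_set m 1) 5"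
proof -
  define C where "C = (cycle_mat m :: 'a mat)"
  define d where "d = mat 1 1 (\<lambda>_. inverse (det C))"
  have ind: "C $$ (i,j) = (if i = Suc j mod m then 1 else 0)" if "i < m" "j < m" for i j
    unfolding C_def using that by (simp add: cycle_mat_def)
  have C: "C \<in> GL m" "C \<in> carrier_mat m m" "det C \<noteq> 0" using cycle_mat_GL[of m, where 'a='a] by (simp_all add: C_def GL_det)
  have d: "d \<in> carrier_mat 1 1" "det d = inverse (det C)" by (simp_all add: d_def det_single)
  then have dG: "d \<in> GL 1" using C by (simp add: GL_det)
  let ?M = "four_block_mat C (0\<^sub>m m 1) (0\<^sub>m 1 m) d"
  have "det ?M = 1" using C d by (simp add: det_four_block_mat_upper_right_zero[of C m _ 1])
  then have "?M \<in> SL (m + 1)" using C d by (auto simp: SL_def GL_det)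
  moreover have "?M \<notin> mat_set_power (m + 1) (T_set m 1) 5"
  proof
    assume "?M \<in> mat_set_power (m + 1) (T_set m 1) 5"
    then consider "five_obstruction m 1 C d" | "five_obstruction m 1 (transpose_mat C) (transpose_mat d)"
      using five_obstruction_of_power[OF C(2) dG] by blast
    then show False
    proof cases
      case 1
      from five_obstruction_column[OF this, of 2 1 0] m show False by (simp add: ind One_nat_def)
    next
      case 2
      from five_obstruction_column[OF this, of 0 1 2] m C(2) show False by (simp add: ind One_nat_def)
    qed
  qed
  ultimately show ?thesis by blast
qed

text \<open>The diagonal entry \<open>x\<close> of \<open>E\<close> makes the trace obstruction effective in every
  characteristic: it is taken to be 0 if and only if \<open>m \<noteq> n\<close> in the field.\<close>

lemma five_factors_fail_trace:
  assumes m: "m \<ge> 2" and n: "n \<ge> 2"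
  shows "\<exists>M \<in> SL (m + n) :: 'a::field mat set. M \<notin> mat_set_power (m + n) (T_set m n) 5"
proof -
  define x where "x = (if (of_nat m :: 'a) = of_nat n then 1 else (0::'a))"
  \<comment> \<open>\<open>E\<close> will be the inverse of \<open>d\<close>, of which the trace
    identity sees only the diagonal. A cycle with one additional corner entry leaves a single
    unknown coefficient, \<open>g (n - 1)\<close>.\<close>
  define E where "E = mat n n (\<lambda>(i,j). (if i = Suc j mod n then 1 else 0) + (if Suc i = n \<and> Suc j = n then x else 0))"
  have Ec: "E \<in> carrier_mat n n" by (simp add: E_def)
  have Ediag: "E $$ (j,j) = (if Suc j = n then x else 0)" if "j < n" for j
    using that n by (auto simp: E_def mod_Suc)
  have "E \<in> GL n"
  proof (rule GL_left_kernel[OF Ec])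
    fix \<xi> :: "'a mat" assume \<xi>: "\<xi> \<in> carrier_mat 1 n" "\<xi> * E = 0\<^sub>m 1 n"
    have ent: "\<xi> $$ (0, Suc j mod n) + (if Suc j = n then \<xi> $$ (0,j) * x else 0) = 0" if j: "j < n" for j
    proof -
      have "0 = (\<xi> * E) $$ (0,j)" unfolding \<xi>(2) using j by simp
      also have "\<dots> = (\<Sum>k = 0..<n. \<xi> $$ (0,k) * E $$ (k,j))"
        using j \<xi>(1) Ec by (simp add: scalar_prod_def)
      also have "\<dots> = (\<Sum>k = 0..<n. (if k = Suc j mod n then \<xi> $$ (0,k) else 0)
          + (if k = j then (if Suc j = n then \<xi> $$ (0,k) * x else 0) else 0))"
        using j by (intro sum.cong) (auto simp: E_def algebra_simps)
      also have "\<dots> = \<xi> $$ (0, Suc j mod n) + (if Suc j = n then \<xi> $$ (0,j) * x else 0)"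
        using j by (simp add: sum.distrib)
      finally show ?thesis by simp
    qed
    have pos: "\<xi> $$ (0, Suc j) = 0" if "Suc j < n" for j using ent[of j] that by simp
    obtain k where k: "n = Suc (Suc k)" using n by (metis One_nat_def Suc_le_D le_SucE numeral_2_eq_2 add_2_eq_Suc le_Suc_ex)
    \<comment> \<open>In the last column \<open>x\<close> is multiplied by the last coordinate,
      which vanishes already because \<open>n \<ge> 2\<close>.\<close>
    have "\<xi> $$ (0, 0) = 0" using ent[of "Suc k"] pos[of k] k by simp
    then have "\<xi> $$ (0, j) = 0" if "j < n" for j using pos that by (cases j) auto
    then show "\<xi> = 0\<^sub>m 1 n" using \<xi>(1) by (intro eq_matI) auto
  qed
  then obtain d where d: "d \<in> GL n" "d * E = 1\<^sub>m n" "E * d = 1\<^sub>m n" using GL_inverse by metis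
  note c = Ec GL_carrier[OF d(1)]
  have det: "det d \<noteq> 0" "det (cycle_mat m :: 'a mat) \<noteq> 0"
    using d cycle_mat_GL[of m, where 'a='a] by (simp_all add: GL_det)
  \<comment> \<open>Rescaling one row of the cycle corrects the determinant and keeps the diagonal
    zero.\<close>
  define a where "a = multrow 0 (inverse (det d * det (cycle_mat m))) (cycle_mat m)"
  have ac: "a \<in> carrier_mat m m" unfolding a_def by simp
  have deta: "det a * det d = 1" unfolding a_def using m det by (simp add: det_multrow[of _ m] field_simps)
  have adiag: "a $$ (i,i) = 0" if "i < m" for i
    unfolding a_def using that m by (auto simp: cycle_mat_def mod_Suc)
  let ?M = "four_block_mat a (0\<^sub>m m n) (0\<^sub>m n m) d"
  have "det ?M = 1" using c ac deta by (simp add: det_four_block_mat_upper_right_zero[of a m _ n])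
  then have "?M \<in> SL (m + n)" using c ac by (auto simp: SL_def GL_det)
  moreover have "?M \<notin> mat_set_power (m + n) (T_set m n) 5"
  proof
    assume "?M \<in> mat_set_power (m + n) (T_set m n) 5"
    then consider "five_obstruction m n a d" | "five_obstruction m n (transpose_mat a) (transpose_mat d)"
      using five_obstruction_of_power[OF ac d(1)] by blast
    then have "\<exists>g. (\<forall>j<n. g j \<noteq> 0) \<and> of_nat m + (\<Sum>j = 0..<n. g j * E $$ (j,j)) = (of_nat n :: 'a)"
    proof cases
      case 1
      then show ?thesis using five_obstruction_trace[of m n a d E] ac adiag Ec d by blast
    next
      case 2
      have "transpose_mat d * transpose_mat E = transpose_mat (E * d)" using c by (simp add: transpose_mult[of _ n n _ n])
      also have "\<dots> = 1\<^sub>m n" unfolding d(3) by simp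
      finally have "\<exists>g. (\<forall>j<n. g j \<noteq> 0) \<and> of_nat m + (\<Sum>j = 0..<n. g j * transpose_mat E $$ (j,j)) = (of_nat n :: 'a)"
        using five_obstruction_trace[OF 2, of "transpose_mat E"] ac adiag Ec by simp
      then show ?thesis using Ec by simp
    qed
    then obtain g where g: "\<And>j. j < n \<Longrightarrow> g j \<noteq> 0"
      "of_nat m + (\<Sum>j = 0..<n. g j * E $$ (j,j)) = (of_nat n :: 'a)" by blast
    have "(\<Sum>j = 0..<n. g j * E $$ (j,j)) = (\<Sum>j = 0..<n. if j = n - 1 then g (n - 1) * x else 0)"
      using n by (intro sum.cong) (auto simp: Ediag)
    also have "\<dots> = g (n - 1) * x" using n by simp
    finally have "of_nat m + g (n - 1) * x = (of_nat n :: 'a)" using g(2) by simp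
    then show False using g(1)[of "n - 1"] n by (auto simp: x_def split: if_splits)
  qed
  ultimately show ?thesis by blast
qed

theorem theorem0p2:
  shows "(\<forall>n>0. \<forall>M \<in> GL (2 * n) :: 'a::field mat set. \<forall>D \<in> GL n :: 'a mat set.
            diagonal_mat D \<longrightarrow> det D = det M \<longrightarrow>
            (\<exists>A1 \<in> carrier_mat n n. \<exists>A2 \<in> carrier_mat n n. \<exists>A3 \<in> carrier_mat n n.
             \<exists>A4 \<in> carrier_mat n n. \<exists>A5 \<in> carrier_mat n n. \<exists>A6 \<in> carrier_mat n n.
               M = four_block_mat (1\<^sub>m n) (0\<^sub>m n n) A1 (1\<^sub>m n)
                 * four_block_mat (1\<^sub>m n) A2 (0\<^sub>m n n) (1\<^sub>m n)
                 * four_block_mat (1\<^sub>m n) (0\<^sub>m n n) A3 (1\<^sub>m n)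
                 * four_block_mat (1\<^sub>m n) A4 (0\<^sub>m n n) (1\<^sub>m n)
                 * four_block_mat (1\<^sub>m n) (0\<^sub>m n n) A5 (1\<^sub>m n)
                 * four_block_mat D A6 (0\<^sub>m n n) (1\<^sub>m n))) \<and>
         (\<forall>m n. 0 < m \<longrightarrow> 0 < n \<longrightarrow> m + n > 3 \<longrightarrow>
            (\<exists>M \<in> SL (m + n) :: 'a mat set. M \<notin> mat_set_power (m + n) (T_set m n) 5))"
proof (rule conjI)
  show "\<forall>m n. 0 < m \<longrightarrow> 0 < n \<longrightarrow> m + n > 3 \<longrightarrow>
      (\<exists>M \<in> SL (m + n) :: 'a mat set. M \<notin> mat_set_power (m + n) (T_set m n) 5)"
  proof (intro allI impI)
    fix m n :: nat assume mn: "0 < m" "0 < n" "m + n > 3"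
    \<comment> \<open>The bound on \<open>m + n\<close> ensures a cycle of length at least three
      whenever one block has size one.\<close>
    then consider "m = 1" "n \<ge> 3" | "n = 1" "m \<ge> 3" | "m \<ge> 2" "n \<ge> 2" by linarith
    then show "\<exists>M \<in> SL (m + n) :: 'a mat set. M \<notin> mat_set_power (m + n) (T_set m n) 5"
      using five_factors_fail_row five_factors_fail_column five_factors_fail_trace by cases blast+
  qed
qed (use six_block_factors in blast)

end
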